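(* Let $P$ be a maximal ranked poset. Then the number of triangular $2$-faces of the order polytope $\mathcal O(P)$ equals the number of triangular $2$-faces of the chain polytope $\mathcal C(P)$ if and only if $P$ does not contain an $X$-poset as a subposet.
   Context: For a finite poset $P=\{p_1,\dots,p_d\}$, the order polytope is $\mathcal O(P)=\{x\in\mathbb R^d: 0\le x_i\le 1 \text{ for all } i,\ x_i\ge x_j \text{ if } p_i\le p_j \text{ in } P\}$ and the chain polytope is $\mathcal C(P)=\{x\in\mathbb R^d: x_i\ge 0 \text{ for all } i,\ x_{i_1}+\dots+x_{i_k}\le 1 \text{ if } p_{i_1}<\dots<p_{i_k} \text{ in } P\}$. A triangular 2-face is a 2-dimensional face with exactly three vertices. The length of a chain $C$ is $|C|-1$; $P$ is graded of rank $n$ if every maximal chain has length $n$, and then $P=\bigcup_{i=0}^n P_i$ where every maximal chain is $p_0<\dots<p_n$ with $p_i\in P_i$. $P$ is a maximal ranked poset if it is graded and any two elements of distinct ranks are comparable. $P$ contains an $X$-poset as a subposet if there are five pairwise distinct elements $a,b,c,d,e\in P$ such that $a$ and $b$ are incomparable, $d$ and $e$ are incomparable, and $a<c<d$, $b<c<e$ (the five-element poset with two minimal elements below $c$ and two maximal elements above $c$). *)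

theory Defs
  imports "HOL-Analysis.Analysis"
begin

text \<open>The finite poset P is the finite type 'a with its partial order; points of R^P are
  vectors in real^'a.\<close>

definition order_polytope :: "(real^'a::{finite,order}) set" where
  "order_polytope = {x. (\<forall>i. 0 \<le> x$i \<and> x$i \<le> 1) \<and> (\<forall>i j. i \<le> j \<longrightarrow> x$i \<ge> x$j)}"

definition is_chain :: "'a::order set \<Rightarrow> bool" where
  "is_chain C \<longleftrightarrow> (\<forall>a\<in>C. \<forall>b\<in>C. a \<le> b \<or> b \<le> a)"

definition chain_polytope :: "(real^'a::{finite,order}) set" where
  "chain_polytope = {x. (\<forall>i. 0 \<le> x$i) \<and> (\<forall>C. is_chain C \<longrightarrow> (\<Sum>i\<in>C. x$i) \<le> 1)}"

definition triangular_2faces :: "('n::euclidean_space) set \<Rightarrow> 'n set set" where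
  "triangular_2faces K = {F. F face_of K \<and> aff_dim F = 2 \<and> card {v. v extreme_point_of F} = 3}"

definition maximal_chain :: "'a::order set \<Rightarrow> bool" where
  "maximal_chain C \<longleftrightarrow> is_chain C \<and> (\<forall>D. is_chain D \<and> C \<subseteq> D \<longrightarrow> D = C)"

text \<open>Graded of rank n: every maximal chain has length n (length = cardinality - 1).\<close>
definition graded_rank :: "'a::{finite,order} itself \<Rightarrow> nat \<Rightarrow> bool" where
  "graded_rank _ n \<longleftrightarrow> (\<forall>C::'a set. maximal_chain C \<longrightarrow> card C - 1 = n)"

definition rank_level :: "nat \<Rightarrow> 'a::{finite,order} set" where
  "rank_level i = {p. \<exists>C. maximal_chain C \<and> p \<in> C \<and> card {q\<in>C. q < p} = i}"

definition maximal_ranked :: "'a::{finite,order} itself \<Rightarrow> bool" where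
  "maximal_ranked T \<longleftrightarrow> (\<exists>n. graded_rank T n) \<and>
     (\<forall>i j (p::'a) q. i \<noteq> j \<and> p \<in> rank_level i \<and> q \<in> rank_level j \<longrightarrow> p \<le> q \<or> q \<le> p)"

definition contains_X :: "'a::order itself \<Rightarrow> bool" where
  "contains_X _ \<longleftrightarrow> (\<exists>a b c d e::'a. distinct [a,b,c,d,e] \<and>
     \<not> (a \<le> b) \<and> \<not> (b \<le> a) \<and> \<not> (d \<le> e) \<and> \<not> (e \<le> d) \<and>
     a < c \<and> c < d \<and> b < c \<and> c < e)"

end

theory Submission
  imports Defs
begin

text \<open>
  The vertices of the order polytope are the indicator vectors of the downsets and those of the
  chain polytope are the indicator vectors of the antichains.  For the posets at hand, three vertices
  span a triangular face if and only if no two of them have the same sum as some other pair of vertices: for the order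
  polytope this means that the downsets form a flag \<open>I \<subset> J \<subset> K\<close> with connected differences,
  for the chain polytope that the pairwise symmetric differences of the antichains are connected.

  A maximal ranked poset is a stack of antichains, each lying completely below the next one.
  Encoding a downset by its maximal elements, both kinds of triangles become triples of antichains.
  Exchanging the empty antichain with a complete level and, where that is not enough, inserting a
  complete level, maps the order triangles injectively to the chain triangles; the chain
  triangles that are missed are the triples \<open>A < B < C\<close> where \<open>B\<close> is the complete level just below
  \<open>C\<close> and both \<open>A\<close> and \<open>C\<close> have at least two elements.  Such a triple contains an X-poset.
\<close>

section \<open>Triangular faces of 0/1 polytopes\<close>

text \<open>The two polytopes restrict different antichains. Passing from the complete level just
  below \<open>C\<close> to \<open>C\<close> adds exactly the elements of \<open>C\<close> to the
  downset, so the order polytope admits this pair only if \<open>C\<close> is a singleton; the chain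
  polytope puts the same restriction on passing from \<open>{}\<close> to \<open>C\<close>. In the
  first place of a triple the two can be traded. In the middle place they cannot, because the middle
  of an increasing triple is never empty, and the losses have to be compared directly. On the chain
  side a lost triple is \<open>({}, {b}, C)\<close>, one for each \<open>b\<close> below
  \<open>C\<close>; on the order side it is an admissible \<open>A\<close> in front of the complete
  level below \<open>C\<close>. A single \<open>b\<close> pays for \<open>A = {b}\<close> or for the
  level without \<open>b\<close>, and for nothing else: a surplus remains as soon as
  \<open>A\<close> can have two elements on a lower level. The hypothesis on the poset enters
  through the law that \<open>x < y\<close> implies \<open>x < z\<close> or \<open>z < y\<close>. It
  makes a difference of downsets connected as soon as it contains one comparable pair, so that
  necessary conditions on pairs of vertices become sufficient.\<close>

definition ind :: "'a set \<Rightarrow> real^'a::finite" where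
  "ind A = (\<chi> i. if i \<in> A then 1 else 0)"

lemma ind_nth [simp]: "ind A $ i = (if i \<in> A then 1 else 0)"
  by (simp add: ind_def)

lemma ind_eq_iff [simp]: "ind A = ind B \<longleftrightarrow> A = B"
  by (auto simp: vec_eq_iff split: if_splits)

lemma inj_ind: "inj ind"
  by (simp add: inj_on_def)

lemma card_ind_image: "card (ind ` S) = card S"
  by (rule card_image) (simp add: inj_on_def)

lemma sum_ind: "(\<Sum>i\<in>C. ind A $ i) = real (card (C \<inter> A))" for C :: "'a::finite set"
  by (simp add: sum.If_cases)

section \<open>Faces cut out by tight linear inequalities\<close>

lemma face_of_tight:
  fixes f :: "'a::real_vector \<Rightarrow> real"
  assumes "convex K" "linear f" "\<And>x. x \<in> K \<Longrightarrow> f x \<le> c"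
  shows "{x \<in> K. f x = c} face_of K"
  unfolding face_of_def
proof (intro conjI ballI impI)
  show "convex {x \<in> K. f x = c}"
    using assms(1)
    by (auto simp: convex_def linear_add[OF assms(2)] linear_cmul[OF assms(2)]
        simp flip: distrib_right)
next
  fix a b x
  assume *: "a \<in> K" "b \<in> K" "x \<in> {x \<in> K. f x = c}" "x \<in> open_segment a b"
  then obtain u where u: "0 < u" "u < 1" "x = (1 - u) *\<^sub>R a + u *\<^sub>R b"
    by (auto simp: in_segment)
  \<comment> \<open>The slacks at both ends, weighted by \<open>1 - u\<close> and \<open>u\<close>,
    add up to the slack at \<open>x\<close>, which is zero.\<close>
  have eq: "(1 - u) * (c - f a) + u * (c - f b) = 0"
  proof -
    have "f x = (1 - u) * f a + u * f b"
      by (simp add: u(3) linear_add[OF assms(2)] linear_cmul[OF assms(2)])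
    then show ?thesis
      using * by (simp add: algebra_simps)
  qed
  moreover have "0 \<le> (1 - u) * (c - f a)" "0 \<le> u * (c - f b)"
    using * u assms(3) by auto
  ultimately have "(1 - u) * (c - f a) = 0" "u * (c - f b) = 0"
    by linarith+
  then show "a \<in> {x \<in> K. f x = c}" "b \<in> {x \<in> K. f x = c}"
    using u * by auto
qed auto

lemma face_of_all:
  assumes "\<And>t. {x \<in> K. P t x} face_of K"
  shows "{x \<in> K. \<forall>t. P t x} face_of K"
proof -
  have "\<Inter> (range (\<lambda>t. {x \<in> K. P t x})) face_of K"
    using assms by (intro face_of_Inter) auto
  also have "\<Inter> (range (\<lambda>t. {x \<in> K. P t x})) = {x \<in> K. \<forall>t. P t x}"
    by auto
  finally show ?thesis .
qed

lemma face_of_conj: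
  assumes "{x \<in> K. P x} face_of K" "{x \<in> K. Q x} face_of K"
  shows "{x \<in> K. P x \<and> Q x} face_of K"
proof -
  have "{x \<in> K. P x \<and> Q x} = {x \<in> K. P x} \<inter> {x \<in> K. Q x}"
    by auto
  then show ?thesis
    using face_of_Int[OF assms] by simp
qed

lemma face_of_imp:
  assumes "convex K" "b \<Longrightarrow> {x \<in> K. P x} face_of K"
  shows "{x \<in> K. b \<longrightarrow> P x} face_of K"
  using assms by (cases b) (auto simp: face_of_refl)

lemma extreme_point_ind:
  assumes "\<And>x i. x \<in> K \<Longrightarrow> 0 \<le> x $ i \<and> x $ i \<le> 1" "ind A \<in> K"
  shows "ind A extreme_point_of K"
  unfolding extreme_point_of_def
proof (intro conjI ballI notI)
  fix a b
  assume *: "a \<in> K" "b \<in> K" "ind A \<in> open_segment a b"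
  then obtain u where u: "a \<noteq> b" "0 < u" "u < 1" "ind A = (1 - u) *\<^sub>R a + u *\<^sub>R b"
    by (auto simp: in_segment)
  have "a $ i = b $ i" for i
  proof -
    have eq: "(if i \<in> A then 1 else 0) = (1 - u) * a $ i + u * b $ i"
      using u(4) by (simp add: vec_eq_iff)
    have ab: "0 \<le> a $ i" "a $ i \<le> 1" "0 \<le> b $ i" "b $ i \<le> 1"
      using assms(1) * by auto
    show ?thesis
    proof (cases "i \<in> A")
      case True
      then have "(1 - u) * (1 - a $ i) + u * (1 - b $ i) = 0"
        using eq by (simp add: algebra_simps)
      then have "(1 - u) * (1 - a $ i) = 0 \<and> u * (1 - b $ i) = 0"
        using ab u by (subst (asm) add_nonneg_eq_0_iff) auto
      then show ?thesis using u by auto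
    next
      case False
      then have "(1 - u) * a $ i = 0 \<and> u * b $ i = 0"
        using ab u eq by (simp add: add_nonneg_eq_0_iff)
      then show ?thesis using u by auto
    qed
  qed
  then show False using u by (simp add: vec_eq_iff)
qed (use assms in auto)

text \<open>Of three collinear points one lies between the other two, which extremality forbids. The
  dimension of a triangular face thus follows from its having three vertices.\<close>

lemma aff_dim_three_extreme_points:
  fixes V :: "'a::euclidean_space set"
  assumes "card V = 3" "\<And>v. v \<in> V \<Longrightarrow> v extreme_point_of (convex hull V)"
  shows "aff_dim V = 2"
proof -
  obtain a b c where V: "V = {a, b, c}" "a \<noteq> b" "a \<noteq> c" "b \<noteq> c"
    using assms(1) by (metis card_3_iff)
  have "\<not> affine_dependent {a, b, c}"
  proof
    assume "affine_dependent {a, b, c}"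
    then have "collinear {a, b, c}"
      by (simp add: collinear_3_eq_affine_dependent)
    then have "between (b, c) a \<or> between (c, a) b \<or> between (a, b) c"
      by (simp add: collinear_between_cases)
    then have "a \<in> open_segment b c \<or> b \<in> open_segment c a \<or> c \<in> open_segment a b"
      using V by (auto simp: between_mem_segment open_segment_def)
    moreover have "a \<in> convex hull V" "b \<in> convex hull V" "c \<in> convex hull V"
      using V hull_subset[of V convex] by auto
    ultimately show False
      using assms(2) V unfolding extreme_point_of_def by blast
  qed
  then show ?thesis
    using aff_dim_affine_independent[of V] V(1) assms(1) by simp
qed

text \<open>A face of a compact convex set is the hull of its extreme points
  (Krein-Milman-Minkowski), and these are extreme points of \<open>K\<close>; counting triangles
  becomes counting triples of sets.\<close>

lemma card_triangular_2faces:
  fixes K :: "(real^'a::finite) set"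
  assumes "compact K" "convex K" "{v. v extreme_point_of K} = ind ` \<V>"
  shows "card (triangular_2faces K)
    = card {S. S \<subseteq> \<V> \<and> card S = 3 \<and> convex hull (ind ` S) face_of K}"
proof -
  have ext: "{v. v extreme_point_of (convex hull (ind ` S))} = ind ` S"
    if "S \<subseteq> \<V>" "convex hull (ind ` S) face_of K" for S
  proof
    show "{v. v extreme_point_of convex hull ind ` S} \<subseteq> ind ` S"
      using extreme_point_of_convex_hull by auto
    have "x extreme_point_of (convex hull (ind ` S))" if "x \<in> ind ` S" for x
    proof -
      have "x extreme_point_of K"
        using that \<open>S \<subseteq> \<V>\<close> assms(3) by auto
      moreover have "x \<in> convex hull (ind ` S)"
        using that by (rule hull_inc)
      ultimately show ?thesis
        using extreme_point_of_face[OF \<open>convex hull (ind ` S) face_of K\<close>] by auto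
    qed
    then show "ind ` S \<subseteq> {v. v extreme_point_of convex hull ind ` S}" by auto
  qed
  have "bij_betw (\<lambda>S. convex hull (ind ` S))
    {S. S \<subseteq> \<V> \<and> card S = 3 \<and> convex hull (ind ` S) face_of K} (triangular_2faces K)"
    unfolding bij_betw_def
  proof
    show "inj_on (\<lambda>S. convex hull (ind ` S))
      {S. S \<subseteq> \<V> \<and> card S = 3 \<and> convex hull (ind ` S) face_of K}"
    proof (rule inj_onI)
      fix S T
      assume *: "S \<in> {S. S \<subseteq> \<V> \<and> card S = 3 \<and> convex hull (ind ` S) face_of K}"
        "T \<in> {S. S \<subseteq> \<V> \<and> card S = 3 \<and> convex hull (ind ` S) face_of K}"
        "convex hull (ind ` S) = convex hull (ind ` T)"
      have "ind ` S = {v. v extreme_point_of (convex hull (ind ` S))}"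
        using *(1) by (intro ext[symmetric]) auto
      also have "\<dots> = {v. v extreme_point_of (convex hull (ind ` T))}"
        by (simp only: *(3))
      also have "\<dots> = ind ` T"
        using *(2) by (intro ext) auto
      finally have "ind ` S = ind ` T" .
      then show "S = T"
        by (simp only: inj_image_eq_iff[OF inj_ind])
    qed
    show "(\<lambda>S. convex hull (ind ` S)) `
      {S. S \<subseteq> \<V> \<and> card S = 3 \<and> convex hull (ind ` S) face_of K} = triangular_2faces K"
    proof (intro equalityI subsetI)
      fix F
      assume "F \<in> (\<lambda>S. convex hull (ind ` S)) `
        {S. S \<subseteq> \<V> \<and> card S = 3 \<and> convex hull (ind ` S) face_of K}"
      then obtain S where S: "S \<subseteq> \<V>" "card S = 3" "F face_of K" "F = convex hull (ind ` S)"
        by auto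
      have c: "card (ind ` S) = 3"
        using S(2) by (simp only: card_ind_image)
      have e: "{v. v extreme_point_of F} = ind ` S"
        using ext[of S] S by blast
      have "aff_dim (ind ` S) = 2"
        using aff_dim_three_extreme_points[OF c] e S(4) by blast
      then show "F \<in> triangular_2faces K"
        using S(3,4) c e by (simp add: triangular_2faces_def aff_dim_convex_hull)
    next
      fix F
      assume "F \<in> triangular_2faces K"
      then have F: "F face_of K" "card {v. v extreme_point_of F} = 3"
        by (auto simp: triangular_2faces_def)
      have "{v. v extreme_point_of F} \<subseteq> ind ` \<V>"
        using extreme_point_of_face[OF F(1)] assms(3) by auto
      then obtain S where S: "S \<subseteq> \<V>" "{v. v extreme_point_of F} = ind ` S"
        by (meson subset_imageE)
      have "compact F" "convex F"
        using F(1) assms by (auto intro: face_of_imp_compact face_of_imp_convex)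
      then have "F = convex hull (ind ` S)"
        using Krein_Milman_Minkowski S(2) by metis
      moreover have "card S = 3"
        using F(2) by (simp only: S(2) card_ind_image)
      ultimately show "F \<in> (\<lambda>S. convex hull (ind ` S)) `
        {S. S \<subseteq> \<V> \<and> card S = 3 \<and> convex hull (ind ` S) face_of K}"
        using S(1) F(1) by blast
    qed
  qed
  then show ?thesis
    by (simp add: bij_betw_same_card)
qed

text \<open>The midpoint of \<open>ind A\<close> and \<open>ind B\<close> is also that of
  \<open>ind A'\<close> and \<open>ind B'\<close>, and a face that contains an interior point of a
  segment contains its ends. All necessary conditions on triangles come from here.\<close>

lemma triangle_face_pair:
  fixes K :: "(real^'a::finite) set"
  assumes ext: "{v. v extreme_point_of K} = ind ` \<V>"
    and S: "S \<subseteq> \<V>" "card S = 3" "convex hull (ind ` S) face_of K"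
    and AB: "A \<in> S" "B \<in> S" "A \<noteq> B"
    and AB': "A' \<in> \<V>" "B' \<in> \<V>" "A' \<inter> B' = A \<inter> B" "A' \<union> B' = A \<union> B"
  shows "A' = A \<and> B' = B \<or> A' = B \<and> B' = A"
proof -
  have sum_eq: "ind A + ind B = ind A' + ind B'"
  proof -
    have "(ind A + ind B) $ i = (ind A' + ind B') $ i" for i
      using AB'(3,4) by (cases "i \<in> A"; cases "i \<in> B"; cases "i \<in> A'"; cases "i \<in> B'") auto
    then show ?thesis by (simp add: vec_eq_iff)
  qed
  have "A' \<noteq> B'"
    using AB' AB(3) by blast
  have half: "(1/2) *\<^sub>R (ind A + ind B) \<in> convex hull (ind ` S)"
  proof -
    have "(1/2) *\<^sub>R ind A + (1/2) *\<^sub>R ind B \<in> convex hull (ind ` S)"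
      using AB by (intro convexD[OF convex_convex_hull] hull_inc) auto
    then show ?thesis by (simp add: scaleR_right_distrib)
  qed
  have "(1/2) *\<^sub>R (ind A + ind B) \<in> open_segment (ind A') (ind B')"
    using \<open>A' \<noteq> B'\<close> unfolding in_segment sum_eq
    by (auto simp: scaleR_right_distrib intro!: exI[of _ "1/2"])
  moreover have e: "ind A' extreme_point_of K" "ind B' extreme_point_of K"
    using AB' ext by auto
  moreover have "ind A' \<in> K" "ind B' \<in> K"
    using e by (auto simp: extreme_point_of_def)
  ultimately have "ind A' \<in> convex hull (ind ` S)" "ind B' \<in> convex hull (ind ` S)"
    using half S(3) unfolding face_of_def by blast+
  then have "ind A' extreme_point_of (convex hull (ind ` S))"
    "ind B' extreme_point_of (convex hull (ind ` S))"
    using e extreme_point_of_face[OF S(3)] by auto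
  then have "A' \<in> S" "B' \<in> S"
    using extreme_point_of_convex_hull by (fastforce simp: image_iff)+
  \<comment> \<open>Two distinct members of a three-element set cannot both avoid \<open>A\<close>
    and \<open>B\<close>; once one is matched, the common intersection and union determine the
    other.\<close>
  moreover obtain C where C: "S = {A, B, C}" "C \<noteq> A" "C \<noteq> B"
  proof -
    have "card (S - {A, B}) = 1"
      using S(2) AB by (subst card_Diff_subset) auto
    then obtain C where "S - {A, B} = {C}" by (auto simp: card_1_singleton_iff)
    then show ?thesis using that[of C] AB by blast
  qed
  ultimately consider "A' = A" | "A' = B" | "B' = A" | "B' = B"
    using \<open>A' \<noteq> B'\<close> by blast
  then show ?thesis
    using AB'(3,4) by cases blast+
qed

section \<open>Vertices of the order and chain polytopes\<close>

definition downset :: "'a::order set \<Rightarrow> bool" where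
  "downset D \<longleftrightarrow> (\<forall>y\<in>D. \<forall>x\<le>y. x \<in> D)"

definition antichain :: "'a::order set \<Rightarrow> bool" where
  "antichain A \<longleftrightarrow> (\<forall>a\<in>A. \<forall>b\<in>A. \<not> a < b)"

text \<open>Splitting off the share \<open>e\<close> of \<open>y\<close> and rescaling the rest
  writes \<open>x\<close> as a proper convex combination of two points of \<open>K\<close>.\<close>

lemma extreme_point_peel:
  assumes "x extreme_point_of K" "0 < e" "e < 1" "y \<in> K" "(1 / (1 - e)) *\<^sub>R (x - e *\<^sub>R y) \<in> K"
  shows "x = y"
proof (rule ccontr)
  define z where "z = (1 / (1 - e)) *\<^sub>R (x - e *\<^sub>R y)"
  assume "x \<noteq> y"
  have x: "x = (1 - e) *\<^sub>R z + e *\<^sub>R y"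
    using assms(3) by (simp add: z_def)
  have "z \<noteq> y"
    using x \<open>x \<noteq> y\<close> by (auto simp flip: scaleR_left_distrib)
  then have "x \<in> open_segment z y"
    using assms(2,3) x by (auto simp: in_segment)
  then show False
    using assms(1,4,5) by (auto simp: extreme_point_of_def z_def)
qed

section \<open>Bounds, compactness, convexity and vertices of the two polytopes\<close>

lemma order_polytope_bounds: "x \<in> order_polytope \<Longrightarrow> 0 \<le> x $ i \<and> x $ i \<le> 1"
  by (simp add: order_polytope_def)

lemma order_polytope_antimono: "x \<in> order_polytope \<Longrightarrow> i \<le> j \<Longrightarrow> x $ j \<le> x $ i"
  by (simp add: order_polytope_def)

lemma chain_polytope_nonneg: "x \<in> chain_polytope \<Longrightarrow> 0 \<le> x $ i"
  by (simp add: chain_polytope_def)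

lemma chain_polytope_sum: "x \<in> chain_polytope \<Longrightarrow> is_chain C \<Longrightarrow> (\<Sum>i\<in>C. x $ i) \<le> 1"
  by (simp add: chain_polytope_def)

lemma chain_polytope_bounds:
  assumes "x \<in> chain_polytope"
  shows "0 \<le> x $ i \<and> x $ i \<le> 1"
  using chain_polytope_nonneg[OF assms, of i] chain_polytope_sum[OF assms, of "{i}"]
  by (auto simp: is_chain_def)

lemma compact_of_unit_bounds:
  fixes K :: "(real^'a::finite) set"
  assumes "closed K" "\<And>x i. x \<in> K \<Longrightarrow> 0 \<le> x $ i \<and> x $ i \<le> 1"
  shows "compact K"
proof -
  have "K \<subseteq> cbox 0 1"
    using assms(2) by (auto simp: mem_box_cart)
  then have "bounded K"
    using bounded_cbox bounded_subset by blast
  then show ?thesis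
    using assms(1) by (simp add: compact_eq_bounded_closed)
qed

lemma compact_order_polytope: "compact order_polytope"
proof (rule compact_of_unit_bounds)
  show "closed (order_polytope :: (real^'a::{finite,order}) set)"
    unfolding order_polytope_def
    by (intro closed_Collect_conj closed_Collect_all closed_Collect_imp closed_Collect_le
        continuous_intros) auto
qed (rule order_polytope_bounds)

lemma compact_chain_polytope: "compact chain_polytope"
proof (rule compact_of_unit_bounds)
  show "closed (chain_polytope :: (real^'a::{finite,order}) set)"
    unfolding chain_polytope_def
    by (intro closed_Collect_conj closed_Collect_all closed_Collect_imp closed_Collect_le
        continuous_intros) auto
qed (rule chain_polytope_bounds)

lemma convex_order_polytope: "convex order_polytope"
  unfolding convex_def order_polytope_def
  by (auto intro!: add_mono mult_left_mono convex_bound_le)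

lemma convex_chain_polytope: "convex chain_polytope"
  unfolding convex_def chain_polytope_def
  by (auto simp: sum.distrib simp flip: sum_distrib_left intro!: convex_bound_le)

lemma ind_order_polytope: "downset D \<Longrightarrow> ind D \<in> order_polytope"
  by (auto simp: order_polytope_def downset_def)

lemma ind_chain_polytope:
  assumes "antichain A"
  shows "ind A \<in> chain_polytope"
proof -
  have "card (C \<inter> A) \<le> 1" if "is_chain C" for C
    using that assms unfolding card_le_Suc0_iff_eq[OF finite] One_nat_def
    by (force simp: is_chain_def antichain_def order_le_less)
  then show ?thesis
    by (auto simp: chain_polytope_def sum_ind simp del: ind_nth) (simp add: ind_def)
qed

lemma extreme_points_order_polytope:
  "{v. v extreme_point_of order_polytope} = ind ` {D :: 'a::{finite,order} set. downset D}"
proof (intro equalityI subsetI)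
  fix x :: "real^('a::{finite,order})"
  assume "x \<in> {v. v extreme_point_of order_polytope}"
  then have ext: "x extreme_point_of order_polytope" by simp
  then have x: "x \<in> order_polytope" by (simp add: extreme_point_of_def)
  define I where "I = {i. 0 < x $ i}"
  have I0: "x $ i = 0" if "i \<notin> I" for i
    using that order_polytope_bounds[OF x, of i] by (simp add: I_def)
  have I: "downset I"
    using order_polytope_antimono[OF x] by (fastforce simp: downset_def I_def)
  have "x = ind I"
  proof (cases "I = {}")
    case True
    then show ?thesis using I0 by (simp add: vec_eq_iff)
  next
    case False
    \<comment> \<open>The least positive coordinate is the largest share of \<open>ind I\<close>
      that can be removed without making a coordinate negative; if \<open>e = 1\<close>, the point
      is already 0/1.\<close>
    define e where "e = Min ((\<lambda>i. x $ i) ` I)"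
    have e_in: "e \<in> (\<lambda>i. x $ i) ` I"
      unfolding e_def using False by (intro Min_in) auto
    have e_le: "e \<le> x $ i" if "i \<in> I" for i
      unfolding e_def using that by (intro Min_le) auto
    have "0 < e" "e \<le> 1"
      using e_in order_polytope_bounds[OF x] by (auto simp: I_def)
    show ?thesis
    proof (cases "e = 1")
      case True
      then show ?thesis
        using e_le I0 order_polytope_bounds[OF x] by (auto simp: vec_eq_iff intro: antisym)
    next
      case False
      then have e: "0 < e" "e < 1" using \<open>0 < e\<close> \<open>e \<le> 1\<close> by auto
      have "(1 / (1 - e)) *\<^sub>R (x - e *\<^sub>R ind I) \<in> order_polytope"
      proof -
        have "0 \<le> x $ i - e * ind I $ i" "x $ i - e * ind I $ i \<le> 1 - e" for i
          using e_le I0 order_polytope_bounds[OF x, of i] e by auto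
        moreover have "x $ j - e * ind I $ j \<le> x $ i - e * ind I $ i" if "i \<le> j" for i j
          using e_le[of i] I0 I order_polytope_antimono[OF x that] that by (auto simp: downset_def)
        ultimately show ?thesis
          using e by (auto simp: order_polytope_def divide_simps)
      qed
      then show ?thesis
        using extreme_point_peel[OF ext e ind_order_polytope[OF I]] by simp
    qed
  qed
  then show "x \<in> ind ` {D. downset D}"
    using I by blast
next
  fix x :: "real^('a::{finite,order})"
  assume "x \<in> ind ` {D :: 'a::{finite,order} set. downset D}"
  then show "x \<in> {v. v extreme_point_of order_polytope}"
    using extreme_point_ind[OF order_polytope_bounds ind_order_polytope] by auto
qed

text \<open>The support need not be an antichain, so the indicator of its minimal elements is peeled
  off. What has to be seen is that all remaining chain sums are at most \<open>1 - e\<close>, even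
  along chains avoiding these elements.\<close>

lemma extreme_points_chain_polytope:
  "{v. v extreme_point_of chain_polytope} = ind ` {A :: 'a::{finite,order} set. antichain A}"
proof (intro equalityI subsetI)
  fix x :: "real^('a::{finite,order})"
  assume "x \<in> {v. v extreme_point_of chain_polytope}"
  then have ext: "x extreme_point_of chain_polytope" by simp
  then have x: "x \<in> chain_polytope" by (simp add: extreme_point_of_def)
  define S where "S = {i. 0 < x $ i}"
  define A where "A = {i\<in>S. \<forall>j\<in>S. \<not> j < i}"
  have S0: "x $ i = 0" if "i \<notin> S" for i
    using that chain_polytope_nonneg[OF x, of i] by (simp add: S_def)
  have A: "antichain A"
    by (auto simp: antichain_def A_def)
  have below: "\<exists>a\<in>A. a \<le> s" if "s \<in> S" for s
    using finite_has_minimal2[OF finite that] by (force simp: A_def order_less_le)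
  have "x = ind A"
  proof (cases "A = {}")
    case True
    then show ?thesis using S0 below by (auto simp: vec_eq_iff)
  next
    case False
    define e where "e = Min ((\<lambda>i. x $ i) ` A)"
    have e_in: "e \<in> (\<lambda>i. x $ i) ` A"
      unfolding e_def using False by (intro Min_in) auto
    have e_le: "e \<le> x $ i" if "i \<in> A" for i
      unfolding e_def using that by (intro Min_le) auto
    have "0 < e" "e \<le> 1"
      using e_in chain_polytope_bounds[OF x] by (auto simp: A_def S_def)
    \<comment> \<open>A chain that meets \<open>A\<close> loses at least \<open>e\<close>. A chain
      that misses \<open>A\<close> but meets the support has slack \<open>e\<close>: some
      \<open>a\<close> in \<open>A\<close> lies below its least supported element, and the supported
      part of the chain can be extended by \<open>a\<close>.\<close>
    have sum_le: "(\<Sum>i\<in>C. x $ i) - e * card (C \<inter> A) \<le> 1 - e" if C: "is_chain C" for C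
    proof (cases "C \<inter> A = {}")
      case False
      then have "1 \<le> card (C \<inter> A)"
        by (simp add: Suc_leI card_gt_0_iff)
      then have "e \<le> e * card (C \<inter> A)"
        using \<open>0 < e\<close> by simp
      then show ?thesis
        using chain_polytope_sum[OF x C] by simp
    next
      case True
      have C_eq: "(\<Sum>i\<in>C. x $ i) = (\<Sum>i\<in>C \<inter> S. x $ i)"
        using S0 by (intro sum.mono_neutral_right) auto
      show ?thesis
      proof (cases "C \<inter> S = {}")
        case True
        then show ?thesis using C_eq \<open>C \<inter> A = {}\<close> \<open>e \<le> 1\<close> by simp
      next
        case False
        then obtain m where m: "m \<in> C \<inter> S" "\<And>b. b \<in> C \<inter> S \<Longrightarrow> b \<le> m \<Longrightarrow> m = b"
          using finite_has_minimal[of "C \<inter> S"] by auto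
        then obtain a where a: "a \<in> A" "a \<le> m"
          using below by blast
        have "m \<le> b" if "b \<in> C \<inter> S" for b
          using C m that unfolding is_chain_def by (metis IntD1 order_refl)
        then have "is_chain (insert a (C \<inter> S))"
          using C a unfolding is_chain_def by (auto intro: order_trans)
        from chain_polytope_sum[OF x this] have "x $ a + (\<Sum>i\<in>C \<inter> S. x $ i) \<le> 1"
          using a True by (subst (asm) sum.insert) auto
        then show ?thesis
          using e_le[OF a(1)] True C_eq by simp
      qed
    qed
    show ?thesis
    proof (cases "e = 1")
      case True
      have "x $ i = 1" if "i \<in> A" for i
        using that e_le True chain_polytope_bounds[OF x, of i] by force
      moreover have "x $ i = 0" if i: "i \<notin> A" for i
      proof -
        have "(\<Sum>j\<in>{i}. x $ j) - e * card ({i} \<inter> A) \<le> 1 - e"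
          by (intro sum_le) (simp add: is_chain_def)
        then show ?thesis
          using i True chain_polytope_nonneg[OF x, of i] by simp
      qed
      ultimately show ?thesis by (simp add: vec_eq_iff)
    next
      case False
      then have e: "0 < e" "e < 1" using \<open>0 < e\<close> \<open>e \<le> 1\<close> by auto
      have "(1 / (1 - e)) *\<^sub>R (x - e *\<^sub>R ind A) \<in> chain_polytope"
      proof -
        have "0 \<le> x $ i - e * ind A $ i" for i
          using e_le chain_polytope_nonneg[OF x, of i] by auto
        moreover have "(\<Sum>i\<in>C. x $ i - e * ind A $ i) \<le> 1 - e" if "is_chain C" for C
          using sum_le[OF that] by (simp only: sum_subtractf sum_ind flip: sum_distrib_left)
        ultimately show ?thesis
          using e by (auto simp: chain_polytope_def simp flip: sum_divide_distrib)
      qed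
      then show ?thesis
        using extreme_point_peel[OF ext e ind_chain_polytope[OF A]] by simp
    qed
  qed
  then show "x \<in> ind ` {A. antichain A}"
    using A by blast
next
  fix x :: "real^('a::{finite,order})"
  assume "x \<in> ind ` {A :: 'a::{finite,order} set. antichain A}"
  then show "x \<in> {v. v extreme_point_of chain_polytope}"
    using extreme_point_ind[OF chain_polytope_bounds ind_chain_polytope] by auto
qed

section \<open>Triangular faces of the order and chain polytopes\<close>

definition cover :: "'a set \<Rightarrow> 'a set \<Rightarrow> bool" where
  "cover A B \<longleftrightarrow> (\<exists>p. p \<notin> A \<and> B = insert p A)"

definition below :: "'a::order set \<Rightarrow> 'a set \<Rightarrow> bool" where
  "below A B \<longleftrightarrow> (\<forall>a\<in>A. \<forall>b\<in>B. a < b)"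

text \<open>For \<open>I\<close> properly inside \<open>J\<close>, this tests whether
  \<open>J - I\<close> is connected in the comparability graph: necessary in every poset, sufficient
  on a weak order.\<close>

definition link :: "'a::order set \<Rightarrow> 'a set \<Rightarrow> bool" where
  "link I J \<longleftrightarrow> cover I J \<or> (\<exists>x\<in>J - I. \<exists>y\<in>J - I. x < y)"

lemma face_of_coord_zero:
  fixes K :: "(real^'n) set"
  assumes "convex K" "\<And>x. x \<in> K \<Longrightarrow> 0 \<le> x $ i"
  shows "{x \<in> K. x $ i = 0} face_of K"
  using face_of_tight[OF assms(1), of "\<lambda>x. - x $ i" 0] assms(2)
  by (simp add: linear_iff)

lemma mem_convex_hull_3I:
  assumes "0 \<le> u" "0 \<le> v" "0 \<le> w" "u + v + w = 1" "x = u *\<^sub>R a + v *\<^sub>R b + w *\<^sub>R c"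
  shows "x \<in> convex hull {a, b, c}"
  using assms unfolding convex_hull_3 by blast

text \<open>The way every triangle is exhibited: \<open>F\<close> is cut out by tight inequalities,
  and each of its points is written as a convex combination of the vertices.\<close>

lemma face_of_eq_convex_hull:
  assumes "F face_of K" "V \<subseteq> F" "F \<subseteq> convex hull V"
  shows "convex hull V face_of K"
proof -
  have "convex hull V = F"
    using assms face_of_imp_convex by (intro antisym hull_minimal) auto
  then show ?thesis using assms(1) by simp
qed

section \<open>Necessary conditions on two vertices of a triangle\<close>

lemma order_triangle_linked:
  fixes S :: "'a::{finite,order} set set"
  assumes S: "S \<subseteq> {D. downset D}" "card S = 3" "convex hull (ind ` S) face_of order_polytope"
    and "I \<in> S" "J \<in> S" "I \<noteq> J"
  shows "I \<subset> J \<and> link I J \<or> J \<subset> I \<and> link J I"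
proof -
  note pair = triangle_face_pair[OF extreme_points_order_polytope S]
  have link: "link I J" if IJ: "I \<in> S" "J \<in> S" "I \<subset> J" for I J
  proof (rule ccontr)
    assume "\<not> link I J"
    then have *: "\<not> cover I J" "\<And>x y. x \<in> J - I \<Longrightarrow> y \<in> J - I \<Longrightarrow> \<not> x < y"
      by (auto simp: link_def)
    \<comment> \<open>\<open>J - I\<close> is an antichain with at least two elements, so moving one
      element \<open>p\<close> from \<open>J\<close> to \<open>I\<close> leaves two downsets with
      the same sum as before.\<close>
    obtain p where p: "p \<in> J - I" using IJ by auto
    have D: "downset I" "downset J" using S(1) IJ by auto
    have "downset (insert p I)"
      using D p *(2) unfolding downset_def by (metis DiffI DiffD1 insert_iff order_le_less)
    moreover have "downset (J - {p})"
      using D p *(2) unfolding downset_def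
      by (metis Diff_iff empty_iff insert_iff order_le_less)
    ultimately have "J = insert p I"
      using pair[of I J "insert p I" "J - {p}"] IJ p by auto
    then show False
      using *(1) p by (auto simp: cover_def)
  qed
  have "downset I" "downset J" using S(1) assms by auto
  then have "downset (I \<inter> J)" "downset (I \<union> J)"
    by (auto simp: downset_def)
  then have "I \<subset> J \<or> J \<subset> I"
    using pair[of I J "I \<inter> J" "I \<union> J"] assms(4-6) by auto
  then show ?thesis
    using link assms(4,5) by blast
qed

text \<open>Every subset of the antichain \<open>A \<union> B\<close> is an antichain, so the same
  two exchanges are available as for downsets. In a stack of levels the remaining pairs, nonempty
  and on different levels, turn out to need no condition.\<close>

lemma chain_triangle_linked:
  fixes S :: "'a::{finite,order} set set"
  assumes S: "S \<subseteq> {A. antichain A}" "card S = 3" "convex hull (ind ` S) face_of chain_polytope"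
    and "A \<in> S" "B \<in> S" "A \<noteq> B" "antichain (A \<union> B)"
  shows "cover A B \<or> cover B A"
proof -
  note pair = triangle_face_pair[OF extreme_points_chain_polytope S]
  have cover: "cover A B" if AB: "A \<in> S" "B \<in> S" "A \<subset> B" for A B
  proof -
    obtain p where p: "p \<in> B - A" using AB by auto
    have "antichain B" using S(1) AB by auto
    then have "antichain (insert p A)" "antichain (B - {p})"
      using AB p unfolding antichain_def by blast+
    then have "B = insert p A"
      using pair[of A B "insert p A" "B - {p}"] AB p by auto
    then show ?thesis
      using p by (auto simp: cover_def)
  qed
  have "antichain (A \<inter> B)"
    using assms(7) by (auto simp: antichain_def)
  then have "A \<subset> B \<or> B \<subset> A"
    using pair[of A B "A \<inter> B" "A \<union> B"] assms(4-7) by auto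
  then show ?thesis
    using cover assms(4,5) by blast
qed

section \<open>Triangles of the chain polytope\<close>

lemma face_of_chain_sum:
  fixes C :: "'a::{finite,order} set"
  assumes "is_chain C"
  shows "{x \<in> chain_polytope. (\<Sum>i\<in>C. x $ i) = 1} face_of chain_polytope"
proof (rule face_of_tight[OF convex_chain_polytope])
  show "linear (\<lambda>x :: real^('a::{finite,order}). \<Sum>i\<in>C. x $ i)"
    by (simp add: linear_iff sum.distrib sum_distrib_left)
qed (rule chain_polytope_sum[OF _ assms])

lemma chain_polytope_face_tight:
  "{x \<in> chain_polytope. (\<forall>i. i \<notin> U \<longrightarrow> x $ i = 0) \<and>
      (\<forall>C. is_chain C \<and> C \<in> \<C> \<longrightarrow> (\<Sum>i\<in>C. x $ i) = 1)} face_of chain_polytope"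
  by (intro face_of_conj face_of_all face_of_imp convex_chain_polytope face_of_coord_zero
      face_of_chain_sum chain_polytope_nonneg) auto

text \<open>Tightness along all chains through \<open>A\<close>, \<open>B\<close> and
  \<open>C\<close> makes \<open>x\<close> constant on each of them; the three constants sum to 1 and
  are the convex weights.\<close>

lemma chain_triangle_three_levels:
  fixes A B C :: "'a::{finite,order} set"
  assumes ac: "antichain A" "antichain B" "antichain C"
    and ne: "A \<noteq> {}" "B \<noteq> {}" "C \<noteq> {}" and le: "below A B" "below B C"
  shows "convex hull {ind A, ind B, ind C} face_of chain_polytope"
proof (rule face_of_eq_convex_hull)
  let ?\<C> = "{{a, b, c} | a b c. a \<in> A \<and> b \<in> B \<and> c \<in> C}"
  let ?F = "{x \<in> chain_polytope. (\<forall>i. i \<notin> A \<union> B \<union> C \<longrightarrow> x $ i = 0) \<and>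
      (\<forall>D. is_chain D \<and> D \<in> ?\<C> \<longrightarrow> (\<Sum>i\<in>D. x $ i) = 1)}"
  show "?F face_of chain_polytope"
    by (rule chain_polytope_face_tight)
  obtain a0 b0 c0 where 0: "a0 \<in> A" "b0 \<in> B" "c0 \<in> C" using ne by auto
  have lt: "a < b" "b < c" "a < c" if "a \<in> A" "b \<in> B" "c \<in> C" for a b c
    using le that unfolding below_def by (blast intro: less_trans)+
  have disj: "A \<inter> B = {}" "A \<inter> C = {}" "B \<inter> C = {}"
    using lt 0 by blast+
  have sum3: "(\<Sum>i\<in>{a, b, c}. f i) = f a + f b + f c"
    if "a \<in> A" "b \<in> B" "c \<in> C" for a b c and f :: "'a \<Rightarrow> real"
    using lt[OF that] by (simp add: order_less_imp_not_eq)
  show "{ind A, ind B, ind C} \<subseteq> ?F"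
    using ind_chain_polytope ac disj by (auto simp: sum3)
  show "?F \<subseteq> convex hull {ind A, ind B, ind C}"
  proof
    fix x
    assume x: "x \<in> ?F"
    have x0: "x $ i = 0" if "i \<notin> A \<union> B \<union> C" for i
      using x that by blast
    have s: "x $ a + x $ b + x $ c = 1" if abc: "a \<in> A" "b \<in> B" "c \<in> C" for a b c
    proof -
      have "is_chain {a, b, c}"
        using lt[OF abc] by (auto simp: is_chain_def)
      then have "(\<Sum>i\<in>{a, b, c}. x $ i) = 1"
        using x abc by blast
      then show ?thesis using sum3[OF abc] by simp
    qed
    have cA: "x $ a = x $ a0" if "a \<in> A" for a using s[OF that 0(2,3)] s[OF 0] by simp
    have cB: "x $ b = x $ b0" if "b \<in> B" for b using s[OF 0(1) that 0(3)] s[OF 0] by simp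
    have cC: "x $ c = x $ c0" if "c \<in> C" for c using s[OF 0(1,2) that] s[OF 0] by simp
    have eq: "x = x $ a0 *\<^sub>R ind A + x $ b0 *\<^sub>R ind B + x $ c0 *\<^sub>R ind C"
      unfolding vec_eq_iff
    proof
      fix i
      show "x $ i = (x $ a0 *\<^sub>R ind A + x $ b0 *\<^sub>R ind B + x $ c0 *\<^sub>R ind C) $ i"
      proof -
        consider "i \<in> A" "i \<notin> B" "i \<notin> C" | "i \<in> B" "i \<notin> A" "i \<notin> C"
          | "i \<in> C" "i \<notin> A" "i \<notin> B" | "i \<notin> A \<union> B \<union> C"
          using disj by blast
        then show ?thesis
          by cases (simp_all add: cA[of i] cB[of i] cC[of i] x0[of i])
      qed
    qed
    have nn: "0 \<le> x $ i" for i using x chain_polytope_nonneg by auto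
    show "x \<in> convex hull {ind A, ind B, ind C}"
      using s[OF 0] nn[of a0] nn[of b0] nn[of c0]
      by (intro mem_convex_hull_3I[OF _ _ _ _ eq]) auto
  qed
qed

text \<open>Only chains through \<open>A\<close> are made tight, so the extra element
  \<open>p\<close> of \<open>B\<close> stays free. Comparing its chain inequality with a tight one
  gives \<open>x $ p \<le> x $ a0\<close>, so the weight \<open>x $ a0 - x $ p\<close> of
  \<open>A\<close> is nonnegative.\<close>

lemma chain_triangle_two_levels:
  fixes A B C :: "'a::{finite,order} set"
  assumes ac: "antichain A" "antichain B" "antichain C"
    and ne: "A \<noteq> {}" "cover A B" "C \<noteq> {}" and le: "below B C \<or> below C B"
  shows "convex hull {ind A, ind B, ind C} face_of chain_polytope"
proof (rule face_of_eq_convex_hull)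
  let ?\<C> = "{{a, c} | a c. a \<in> A \<and> c \<in> C}"
  let ?F = "{x \<in> chain_polytope. (\<forall>i. i \<notin> B \<union> C \<longrightarrow> x $ i = 0) \<and>
      (\<forall>D. is_chain D \<and> D \<in> ?\<C> \<longrightarrow> (\<Sum>i\<in>D. x $ i) = 1)}"
  show "?F face_of chain_polytope"
    by (rule chain_polytope_face_tight)
  obtain p where p: "p \<notin> A" "B = insert p A" using ne by (auto simp: cover_def)
  obtain a0 c0 where 0: "a0 \<in> A" "c0 \<in> C" using ne by auto
  have lt: "b < c \<or> c < b" if "b \<in> B" "c \<in> C" for b c
    using le that unfolding below_def by blast
  have disj: "B \<inter> C = {}" "A \<inter> C = {}" "p \<notin> C"
    using lt p by blast+
  have sum2: "(\<Sum>i\<in>{a, c}. f i) = f a + f c"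
    if "a \<in> B" "c \<in> C" for a c and f :: "'a \<Rightarrow> real"
    using lt[OF that] by (auto simp: order_less_imp_not_eq order_less_imp_not_eq2)
  have ch: "is_chain {b, c}" if "b \<in> B" "c \<in> C" for b c
    using lt[OF that] by (auto simp: is_chain_def)
  show "{ind A, ind B, ind C} \<subseteq> ?F"
    using ind_chain_polytope ac disj p by (auto simp: sum2)
  show "?F \<subseteq> convex hull {ind A, ind B, ind C}"
  proof
    fix x
    assume x: "x \<in> ?F"
    have x0: "x $ i = 0" if "i \<notin> B \<union> C" for i
      using x that by blast
    have s: "x $ a + x $ c = 1" if ac: "a \<in> A" "c \<in> C" for a c
    proof -
      have "(\<Sum>i\<in>{a, c}. x $ i) = 1"
        using x ac ch[of a c] p(2) by blast
      then show ?thesis using sum2[of a c] p(2) ac by simp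
    qed
    have cA: "x $ a = x $ a0" if "a \<in> A" for a using s[OF that 0(2)] s[OF 0] by simp
    have cC: "x $ c = x $ c0" if "c \<in> C" for c using s[OF 0(1) that] s[OF 0] by simp
    have "(\<Sum>i\<in>{p, c0}. x $ i) \<le> 1"
      using x p(2) 0 by (intro chain_polytope_sum ch) auto
    then have "x $ p + x $ c0 \<le> 1"
      using sum2[of p c0] p(2) 0 by simp
    then have le_p: "x $ p \<le> x $ a0"
      using s[OF 0] by simp
    have eq: "x = (x $ a0 - x $ p) *\<^sub>R ind A + x $ p *\<^sub>R ind B + x $ c0 *\<^sub>R ind C"
      unfolding vec_eq_iff
    proof
      fix i
      show "x $ i = ((x $ a0 - x $ p) *\<^sub>R ind A + x $ p *\<^sub>R ind B + x $ c0 *\<^sub>R ind C) $ i"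
      proof -
        consider "i \<in> A" "i \<in> B" "i \<notin> C" | "i = p" "i \<in> B" "i \<notin> A" "i \<notin> C"
          | "i \<in> C" "i \<notin> A" "i \<notin> B" | "i \<notin> A" "i \<notin> B \<union> C"
          using disj p by blast
        then show ?thesis
          by cases (simp_all add: cA[of i] cC[of i] x0[of i])
      qed
    qed
    have nn: "0 \<le> x $ i" for i using x chain_polytope_nonneg by auto
    show "x \<in> convex hull {ind A, ind B, ind C}"
      using s[OF 0] nn[of p] nn[of c0] le_p
      by (intro mem_convex_hull_3I[OF _ _ _ _ eq]) auto
  qed
qed

text \<open>No chain is made tight; comparability of \<open>p\<close> and \<open>q\<close> supplies
  \<open>x $ p + x $ q \<le> 1\<close>, whose slack is the weight of the origin.\<close>

lemma chain_triangle_origin: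
  fixes p q :: "'a::{finite,order}"
  assumes "p < q"
  shows "convex hull {ind {}, ind {p}, ind {q}} face_of chain_polytope"
proof (rule face_of_eq_convex_hull)
  let ?F = "{x \<in> chain_polytope. (\<forall>i. i \<notin> {p, q} \<longrightarrow> x $ i = 0) \<and>
      (\<forall>D. is_chain D \<and> D \<in> {} \<longrightarrow> (\<Sum>i\<in>D. x $ i) = 1)}"
  show "?F face_of chain_polytope"
    by (rule chain_polytope_face_tight)
  show "{ind {}, ind {p}, ind {q}} \<subseteq> ?F"
    using ind_chain_polytope by (auto simp: antichain_def)
  show "?F \<subseteq> convex hull {ind {}, ind {p}, ind {q}}"
  proof
    fix x
    assume x: "x \<in> ?F"
    have "is_chain {p, q}" using assms by (auto simp: is_chain_def)
    then have "(\<Sum>i\<in>{p, q}. x $ i) \<le> 1"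
      using x by (intro chain_polytope_sum) auto
    then have le_pq: "x $ p + x $ q \<le> 1" using assms by (simp add: order_less_imp_not_eq)
    have nn: "0 \<le> x $ i" for i using x chain_polytope_nonneg by auto
    have eq: "x = (1 - x $ p - x $ q) *\<^sub>R ind {} + x $ p *\<^sub>R ind {p} + x $ q *\<^sub>R ind {q}"
      unfolding vec_eq_iff
    proof
      fix i
      have "i \<notin> {p, q} \<Longrightarrow> x $ i = 0"
        using x by blast
      then show "x $ i = ((1 - x $ p - x $ q) *\<^sub>R ind {} + x $ p *\<^sub>R ind {p} + x $ q *\<^sub>R ind {q}) $ i"
        using assms by (cases "i = p"; cases "i = q") auto
    qed
    show "x \<in> convex hull {ind {}, ind {p}, ind {q}}"
      using le_pq nn[of p] nn[of q] by (intro mem_convex_hull_3I[OF _ _ _ _ eq]) auto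
  qed
qed

section \<open>Triangles of the order polytope\<close>

lemma face_of_order_coord_one: "{x \<in> order_polytope. x $ i = 1} face_of order_polytope"
  by (intro face_of_tight[OF convex_order_polytope]) (simp_all add: linear_iff order_polytope_bounds)

lemma face_of_order_coord_eq:
  fixes i j :: "'a::{finite,order}"
  assumes "i \<le> j"
  shows "{x \<in> order_polytope. x $ i = x $ j} face_of order_polytope"
proof -
  have "{x \<in> order_polytope. x $ j - x $ i = 0}
    face_of (order_polytope :: (real^('a::{finite,order})) set)"
    using order_polytope_antimono[OF _ assms]
    by (intro face_of_tight[OF convex_order_polytope]) (auto simp: linear_iff algebra_simps)
  moreover have "{x \<in> order_polytope. x $ i = x $ j}
    = {x \<in> (order_polytope :: (real^('a::{finite,order})) set). x $ j - x $ i = 0}"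
    by auto
  ultimately show ?thesis by simp
qed

text \<open>On a weak order, a difference of downsets containing a comparable pair is connected, so the
  equations \<^term>\<open>x $ i = x $ j\<close> for comparable \<^term>\<open>i\<close>, \<^term>\<open>j\<close> make \<^term>\<open>x\<close> constant on it.\<close>

lemma order_triangle_face:
  fixes I J K :: "'a::{finite,order} set"
  assumes weak: "\<And>x y z :: 'a. x < y \<Longrightarrow> x < z \<or> z < y"
    and D: "downset I" "downset J" "downset K" "I \<subset> J" "J \<subset> K"
    and links: "link I J" "link J K" "link I K"
  shows "convex hull {ind I, ind J, ind K} face_of order_polytope"
proof (rule face_of_eq_convex_hull)
  let ?same = "\<lambda>i j. i \<le> j \<and> (i \<in> J - I \<and> j \<in> J - I \<or> i \<in> K - J \<and> j \<in> K - J)"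
  let ?F = "{x \<in> order_polytope. (\<forall>i. i \<in> I \<longrightarrow> x $ i = 1) \<and> (\<forall>i. i \<notin> K \<longrightarrow> x $ i = 0) \<and>
      (\<forall>i j. ?same i j \<longrightarrow> x $ i = x $ j)}"
  show "?F face_of order_polytope"
    by (intro face_of_conj face_of_all face_of_imp convex_order_polytope face_of_coord_zero
        face_of_order_coord_one face_of_order_coord_eq) (auto dest: order_polytope_bounds)
  show "{ind I, ind J, ind K} \<subseteq> ?F"
    using ind_order_polytope D by auto
  show "?F \<subseteq> convex hull {ind I, ind J, ind K}"
  proof
    fix x
    assume x: "x \<in> ?F"
    note x' = x[unfolded mem_Collect_eq]
    have xO: "x \<in> order_polytope" using x' by (rule conjunct1)
    have x1: "x $ i = 1" if "i \<in> I" for i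
      using x'[THEN conjunct2, THEN conjunct1] that by simp
    have x0: "x $ i = 0" if "i \<notin> K" for i
      using x'[THEN conjunct2, THEN conjunct2, THEN conjunct1] that by simp
    have same: "x $ i = x $ j" if "?same i j" for i j
      using x'[THEN conjunct2, THEN conjunct2, THEN conjunct2] that by blast
    have xJ: "x $ i = x $ j" if "i \<in> J - I" "j \<in> J - I" "i \<le> j" for i j
      using that by (intro same) blast
    have xK: "x $ i = x $ j" if "i \<in> K - J" "j \<in> K - J" "i \<le> j" for i j
      using that by (intro same) blast
    have const: "\<exists>v. \<forall>i\<in>N - M. x $ i = v"
      if MN: "link M N" and eq: "\<And>i j. i \<in> N - M \<Longrightarrow> j \<in> N - M \<Longrightarrow> i \<le> j \<Longrightarrow> x $ i = x $ j" for M N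
    proof (cases "cover M N")
      case True
      then show ?thesis by (auto simp: cover_def)
    next
      case False
      then obtain a b where ab: "a \<in> N - M" "b \<in> N - M" "a < b"
        using MN by (auto simp: link_def)
      have "x $ i = x $ a" if "i \<in> N - M" for i
        using weak[OF ab(3), of i] ab eq[OF ab(1) that] eq[OF that ab(2)] eq[OF ab(1,2)] by auto
      then show ?thesis by blast
    qed
    obtain v where v: "\<forall>i\<in>J - I. x $ i = v"
      using const[OF links(1) xJ] by blast
    obtain w where w: "\<forall>i\<in>K - J. x $ i = w"
      using const[OF links(2) xK] by blast
    obtain p where p: "p \<in> J - I" using D by auto
    obtain q where q: "q \<in> K - J" using D by auto
    have "\<not> cover I K"
      using p q D(4,5) by (auto simp: cover_def)
    then obtain a b where ab: "a \<in> K - I" "b \<in> K - I" "a < b"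
      using links(3) by (auto simp: link_def)
    have noJ: "\<not> s < t" if "s \<notin> J" "t \<in> J" for s t
      using that D(2) by (auto simp: downset_def dest: order_less_imp_le)
    \<comment> \<open>A comparable pair straddling \<open>J\<close> yields \<open>w \<le> v\<close>.
      If the pair from \<open>link I K\<close> lies on one side of \<open>J\<close>, the weak order
      law, applied to an element of the other side, moves one end across.\<close>
    have "\<exists>s\<in>J - I. \<exists>t\<in>K - J. s < t"
    proof (cases "a \<in> J"; cases "b \<in> J")
      assume "a \<in> J" "b \<in> J"
      then show ?thesis using weak[OF ab(3), of q] noJ[of q b] ab q by blast
    next
      assume "a \<notin> J" "b \<notin> J"
      then show ?thesis using weak[OF ab(3), of p] noJ[of a p] ab p by blast
    qed (use ab noJ in blast)+
    then have wv: "w \<le> v"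
      using order_polytope_antimono[OF xO] v w by (force dest: order_less_imp_le)
    have vw: "0 \<le> w" "v \<le> 1"
      using order_polytope_bounds[OF xO] v w p q by force+
    \<comment> \<open>The values 1, \<open>v\<close>, \<open>w\<close>, 0 on the successive layers
      descend; their differences are the weights.\<close>
    have eq: "x = (1 - v) *\<^sub>R ind I + (v - w) *\<^sub>R ind J + w *\<^sub>R ind K"
      unfolding vec_eq_iff
    proof
      fix i
      show "x $ i = ((1 - v) *\<^sub>R ind I + (v - w) *\<^sub>R ind J + w *\<^sub>R ind K) $ i"
        using x1 x0 v w D(4,5) by (cases "i \<in> I"; cases "i \<in> J"; cases "i \<in> K") auto
    qed
    show "x \<in> convex hull {ind I, ind J, ind K}"
      using wv vw by (intro mem_convex_hull_3I[OF _ _ _ _ eq]) auto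
  qed
qed

section \<open>Downsets and antichains\<close>

definition down :: "'a::order set \<Rightarrow> 'a set" where
  "down A = {x. \<exists>a\<in>A. x \<le> a}"

lemma downset_down: "downset (down A)"
  unfolding down_def downset_def by (blast intro: order_trans)

text \<open>In \<open>a \<le> b \<le> a'\<close> with \<open>a\<close> and \<open>a'\<close> from
  one antichain all three coincide: an antichain is the set of maximal elements of its
  downset.\<close>

lemma subset_of_down_eq:
  assumes A: "antichain A" and eq: "down A = down B"
  shows "A \<subseteq> B"
proof
  fix a
  assume a: "a \<in> A"
  then have "a \<in> down B"
    unfolding eq[symmetric] by (auto simp: down_def)
  then obtain b where b: "b \<in> B" "a \<le> b"
    by (auto simp: down_def)
  then have "b \<in> down A"
    unfolding eq by (auto simp: down_def)
  then obtain a' where a': "a' \<in> A" "b \<le> a'"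
    by (auto simp: down_def)
  have "\<not> a < a'"
    using A a a'(1) by (auto simp: antichain_def)
  then have "a = b"
    using b(2) a'(2) by auto
  then show "a \<in> B" using b by simp
qed

lemma down_inj: "antichain A \<Longrightarrow> antichain B \<Longrightarrow> down A = down B \<Longrightarrow> A = B"
  using subset_of_down_eq[of A B] subset_of_down_eq[of B A] by simp

lemma downset_eq_down:
  fixes D :: "'a::{finite,order} set"
  assumes "downset D"
  shows "\<exists>A. antichain A \<and> D = down A"
proof (intro exI conjI)
  let ?A = "{x \<in> D. \<forall>y\<in>D. \<not> x < y}"
  show "antichain ?A" by (auto simp: antichain_def)
  have "\<exists>a\<in>?A. x \<le> a" if "x \<in> D" for x
    using finite_has_maximal2[OF finite that] by (force simp: order_less_le)
  then show "D = down ?A"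
    using assms by (auto simp: down_def downset_def)
qed

lemma below_empty [simp]: "below {} B"
  by (simp add: below_def)

lemma not_below_cover: "below A B \<Longrightarrow> cover A B \<Longrightarrow> A = {}"
  by (auto simp: below_def cover_def)

lemma below_trans:
  assumes "below A B" "below B C" "B \<noteq> {}"
  shows "below A C"
proof -
  obtain b where "b \<in> B" using assms(3) by auto
  then show ?thesis
    using assms(1,2) unfolding below_def by (blast intro: less_trans[of _ b])
qed

lemma card_eq_1_iff_cover: "card B = 1 \<longleftrightarrow> cover {} B"
  by (auto simp: cover_def card_1_singleton_iff)

text \<open>With \<open>f\<close> the identity this sorts downsets, with \<open>f = down\<close> it
  sorts antichains.\<close>

lemma strict_chain_of_card_3:
  assumes "card S = 3" "\<And>A B. A \<in> S \<Longrightarrow> B \<in> S \<Longrightarrow> A \<noteq> B \<Longrightarrow> f A \<subset> f B \<or> f B \<subset> f A"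
  obtains A B C where "S = {A, B, C}" "f A \<subset> f B" "f B \<subset> f C"
proof -
  obtain A B C where S: "S = {A, B, C}" "A \<noteq> B" "A \<noteq> C" "B \<noteq> C"
    using assms(1) by (metis card_3_iff)
  have lin: "f A \<subset> f B \<or> f B \<subset> f A" "f A \<subset> f C \<or> f C \<subset> f A" "f B \<subset> f C \<or> f C \<subset> f B"
    using assms(2) S by auto
  have perm: "S = {A, C, B}" "S = {B, A, C}" "S = {B, C, A}" "S = {C, A, B}" "S = {C, B, A}"
    using S(1) by auto
  consider "f A \<subset> f B" "f B \<subset> f C" | "f A \<subset> f C" "f C \<subset> f B" | "f B \<subset> f A" "f A \<subset> f C"
    | "f B \<subset> f C" "f C \<subset> f A" | "f C \<subset> f A" "f A \<subset> f B" | "f C \<subset> f B" "f B \<subset> f A"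
    using lin by argo
  then show thesis
    using S(1) perm by cases (rule that; assumption)+
qed

text \<open>The least and the greatest member are the intersection and the union of the family,
  whatever order it is listed in.\<close>

lemma strict_chain_3_unique:
  assumes "{I, J, K} = {I', J', K'}" "I \<subset> J" "J \<subset> K" "I' \<subset> J'" "J' \<subset> K'"
  shows "I = I' \<and> J = J' \<and> K = K'"
proof -
  have "I = \<Inter> {I, J, K}" "I' = \<Inter> {I', J', K'}" "K = \<Union> {I, J, K}" "K' = \<Union> {I', J', K'}"
    using assms(2-5) by auto
  then have "I = I'" "K = K'"
    using assms(1) by metis+
  moreover have "J \<in> {I', J', K'}" "J \<noteq> I" "J \<noteq> K"
    using assms by auto
  ultimately show ?thesis by auto
qed

lemma card_strict_chain_triples:
  assumes "\<And>A B C. (A, B, C) \<in> T \<Longrightarrow> A \<in> V \<and> B \<in> V \<and> C \<in> V \<and> f A \<subset> f B \<and> f B \<subset> f C"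
    and "inj_on f V"
  shows "card ((\<lambda>(A, B, C). {f A, f B, f C}) ` T) = card T"
    and "card ((\<lambda>(A, B, C). {A, B, C}) ` T) = card T"
proof -
  have inj: "inj_on (\<lambda>(A, B, C). {f A, f B, f C}) T"
  proof (rule inj_onI, simp only: split_paired_all prod.case prod.inject)
    fix A B C A' B' C'
    assume *: "(A, B, C) \<in> T" "(A', B', C') \<in> T" "{f A, f B, f C} = {f A', f B', f C'}"
    have "f A = f A' \<and> f B = f B' \<and> f C = f C'"
      using assms(1)[OF *(1)] assms(1)[OF *(2)] by (intro strict_chain_3_unique *(3)) simp_all
    then show "A = A' \<and> B = B' \<and> C = C'"
      using assms(1)[OF *(1)] assms(1)[OF *(2)] by (simp add: inj_on_eq_iff[OF assms(2)])
  qed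
  then show "card ((\<lambda>(A, B, C). {f A, f B, f C}) ` T) = card T"
    by (rule card_image)
  have "inj_on (\<lambda>(A, B, C). {A, B, C}) T"
  proof (rule inj_onI)
    fix s t
    assume *: "s \<in> T" "t \<in> T" "(\<lambda>(A, B, C). {A, B, C}) s = (\<lambda>(A, B, C). {A, B, C}) t"
    have "(\<lambda>(A, B, C). {f A, f B, f C}) u = f ` (\<lambda>(A, B, C). {A, B, C}) u" for u
      by (cases u) auto
    then show "s = t"
      using inj_onD[OF inj _ *(1,2)] *(3) by presburger
  qed
  then show "card ((\<lambda>(A, B, C). {A, B, C}) ` T) = card T"
    by (rule card_image)
qed

text \<open>Two steps add two elements. This excludes triangles formed by three nonempty antichains
  of one level.\<close>

lemma not_cover_trans:
  assumes "cover A B" "cover B C"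
  shows "\<not> cover A C"
proof
  assume "cover A C"
  then obtain s where s: "C = insert s A" by (auto simp: cover_def)
  obtain p q where "p \<notin> A" "B = insert p A" "q \<notin> B" "C = insert q B"
    using assms by (auto simp: cover_def)
  then have "p \<in> insert s A" "q \<in> insert s A" "p \<notin> A" "q \<notin> A" "p \<noteq> q"
    unfolding s[symmetric] by auto
  then show False by auto
qed

lemma inj_on_down: "inj_on down {A. antichain A}"
proof (rule inj_onI)
  fix A B :: "'a set"
  assume "A \<in> {A. antichain A}" "B \<in> {A. antichain A}" and eq: "down A = down B"
  then have "antichain A" "antichain B" by auto
  then show "A = B" using eq by (rule down_inj)
qed

lemma antichain_empty [simp]: "antichain {}"
  by (simp add: antichain_def)

section \<open>Triples of antichains in a stack of levels\<close>

text \<open>A stack of antichains, each completely below the next. \<open>rank_pred\<close> says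
  that ranks have no gaps, so the level just below an element of positive rank is never
  empty.\<close>

locale ranked_order =
  fixes r :: "'a::{finite,order} \<Rightarrow> nat"
  assumes less_iff: "x < y \<longleftrightarrow> r x < r y"
    and rank_pred: "r x \<noteq> 0 \<Longrightarrow> \<exists>y. Suc (r y) = r x"
begin

lemma le_iff: "x \<le> y \<longleftrightarrow> x = y \<or> r x < r y"
  by (auto simp: order_le_less less_iff)

lemma antichain_rank: "antichain A \<Longrightarrow> a \<in> A \<Longrightarrow> b \<in> A \<Longrightarrow> r a = r b"
  using linorder_neqE_nat[of "r a" "r b"] by (auto simp: antichain_def less_iff)

lemma antichainI: "(\<And>a b. a \<in> A \<Longrightarrow> b \<in> A \<Longrightarrow> r a = r b) \<Longrightarrow> antichain A"
  unfolding antichain_def less_iff by (metis less_irrefl)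

text \<open>The level just below \<^term>\<open>C\<close>; it is empty if \<^term>\<open>C\<close> lies in the bottom level, so that the
  empty set plays the role of a full level of rank \<open>-1\<close>.\<close>

definition prev_level :: "'a set \<Rightarrow> 'a set" where
  "prev_level C = {x. \<exists>c\<in>C. Suc (r x) = r c}"

lemma antichain_prev_level:
  assumes "antichain C"
  shows "antichain (prev_level C)"
proof (rule antichainI)
  fix a b
  assume "a \<in> prev_level C" "b \<in> prev_level C"
  then obtain c d where "c \<in> C" "Suc (r a) = r c" "d \<in> C" "Suc (r b) = r d"
    by (auto simp: prev_level_def)
  then show "r a = r b"
    using antichain_rank[OF assms, of c d] by simp
qed

lemma below_prev_level:
  assumes "antichain C"
  shows "below (prev_level C) C"
  unfolding below_def
proof (intro ballI)
  fix x c
  assume "x \<in> prev_level C" "c \<in> C"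
  then obtain d where "d \<in> C" "Suc (r x) = r d"
    by (auto simp: prev_level_def)
  then show "x < c"
    using antichain_rank[OF assms, of c d] \<open>c \<in> C\<close> by (simp add: less_iff)
qed

lemma prev_level_nonempty:
  assumes "c \<in> C" "x < c"
  shows "prev_level C \<noteq> {}"
proof -
  have "r c \<noteq> 0" using assms(2) by (simp add: less_iff)
  then show ?thesis
    using assms(1) rank_pred[of c] unfolding prev_level_def by blast
qed

lemma prev_level_cover:
  assumes "antichain C" "cover B C" "B \<noteq> {}"
  shows "prev_level C = prev_level B" "B \<noteq> prev_level C" "card C \<noteq> 1"
proof -
  obtain p b where p: "p \<notin> B" "C = insert p B" "b \<in> B"
    using assms by (auto simp: cover_def)
  then have "r p = r b"
    using antichain_rank[OF assms(1)] by simp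
  then show "prev_level C = prev_level B"
    using p by (auto simp: prev_level_def)
  show "card C \<noteq> 1"
    using p by (auto simp: card_1_singleton_iff)
  show "B \<noteq> prev_level C"
    using below_prev_level[OF assms(1)] p by (auto simp: below_def)
qed

section \<open>Inclusions and links of downsets, read off their antichains\<close>

lemma down_psubset_iff:
  fixes A B :: "'a set"
  assumes A: "antichain A" and B: "antichain B"
  shows "down A \<subset> down B \<longleftrightarrow> B \<noteq> {} \<and> (below A B \<or> A \<noteq> {} \<and> A \<subset> B)"
proof
  assume lt: "down A \<subset> down B"
  then obtain b where b: "b \<in> B" by (auto simp: down_def)
  have "below A B \<or> A \<noteq> {} \<and> A \<subset> B"
  proof (cases "A = {}")
    case False
    then obtain a where a: "a \<in> A" by auto
    have le: "\<exists>b\<in>B. x \<le> b" if "x \<in> A" for x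
      using lt that by (auto simp: down_def)
    have ra: "r x = r a" if "x \<in> A" for x using antichain_rank[OF A that a] .
    have rb: "r x = r b" if "x \<in> B" for x using antichain_rank[OF B that b] .
    show ?thesis
    proof (cases "r a < r b")
      case True
      then show ?thesis using ra rb by (auto simp: below_def less_iff)
    next
      case False
      have "x \<in> B" if "x \<in> A" for x
        using le[OF that] ra[OF that] rb False by (auto simp: le_iff)
      moreover have "A \<noteq> B" using lt by auto
      ultimately show ?thesis using a by auto
    qed
  qed simp
  then show "B \<noteq> {} \<and> (below A B \<or> A \<noteq> {} \<and> A \<subset> B)" using b by auto
next
  assume *: "B \<noteq> {} \<and> (below A B \<or> A \<noteq> {} \<and> A \<subset> B)"
  then obtain b where b: "b \<in> B" by auto
  from * consider "below A B" | "A \<subset> B" by auto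
  then show "down A \<subset> down B"
  proof cases
    case 1
    then have "down A \<subseteq> down B"
      using b by (auto simp: down_def below_def dest!: order_less_imp_le intro: order_trans)
    moreover have "b \<in> down B" "b \<notin> down A"
      using 1 b by (auto simp: down_def below_def dest: leD)
    ultimately show ?thesis by blast
  next
    case 2
    then have "down A \<subseteq> down B" by (auto simp: down_def)
    then show ?thesis using 2 down_inj[OF A B] by blast
  qed
qed

text \<open>If \<open>A\<close> is the complete level just below \<open>B\<close>, the difference of
  the downsets is the antichain \<open>B\<close>. For any other \<open>A\<close> some element of
  that level escapes \<open>down A\<close>, and it lies below \<open>B\<close>. For \<open>B\<close>
  in the bottom level the first case applies, with \<open>A\<close> and \<open>prev_level B\<close>
  empty.\<close>

lemma link_down_below:
  fixes A B :: "'a set"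
  assumes A: "antichain A" and B: "antichain B" "B \<noteq> {}" and le: "below A B"
  shows "link (down A) (down B) \<longleftrightarrow> (A = prev_level B \<longrightarrow> card B = 1)"
proof -
  obtain b where b: "b \<in> B" using B by auto
  have rb: "r x = r b" if "x \<in> B" for x using antichain_rank[OF B(1) that b] .
  have sub: "B \<subseteq> down B - down A"
    using le by (force simp: down_def below_def)
  show ?thesis
  proof (cases "A = prev_level B")
    case True
    have diff: "down B - down A = B"
    proof (rule antisym[OF _ sub], rule subsetI)
      fix z
      assume z: "z \<in> down B - down A"
      then obtain b' where b': "b' \<in> B" "z \<le> b'" by (auto simp: down_def)
      show "z \<in> B"
      proof (rule ccontr)
        assume "z \<notin> B"
        then have "r z < r b"
          using b' rb by (auto simp: le_iff)
        then obtain q where q: "Suc (r q) = r b" using rank_pred[of b] by auto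
        then have "q \<in> A" using True b by (auto simp: prev_level_def)
        moreover have "z \<in> A" if "r z = r q"
          using that q True b by (auto simp: prev_level_def)
        moreover have "r z < r q \<or> r z = r q" using \<open>r z < r b\<close> q by linarith
        ultimately show False using z by (auto simp: down_def le_iff)
      qed
    qed
    have "down B = down A \<union> B" "B \<inter> down A = {}"
      using diff sub down_psubset_iff[OF A B(1)] B le by auto
    then have "cover (down A) (down B) \<longleftrightarrow> card B = 1"
      by (auto simp: cover_def card_1_singleton_iff)
    moreover have "link (down A) (down B) \<longleftrightarrow> cover (down A) (down B)"
      using B(1) unfolding link_def diff antichain_def by blast
    ultimately show ?thesis using True by blast
  next
    case False
    have "\<exists>x\<in>prev_level B. x \<notin> down A"
    proof (rule ccontr)
      assume "\<not> ?thesis"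
      then have all: "\<exists>a\<in>A. x \<le> a" if "x \<in> prev_level B" for x
        using that by (auto simp: down_def)
      have "A = prev_level B"
      proof (cases "A = {}")
        case True
        then show ?thesis using all by auto
      next
        case False
        then obtain a where a: "a \<in> A" by auto
        have ra: "r x = r a" if "x \<in> A" for x using antichain_rank[OF A that a] .
        have "a < b" using le a b by (auto simp: below_def)
        then obtain x where x: "x \<in> prev_level B"
          using prev_level_nonempty[OF b] by auto
        have rx: "Suc (r y) = r b" if "y \<in> prev_level B" for y
          using that rb by (auto simp: prev_level_def)
        have "r a = r x"
          using all[OF x] rx[OF x] ra \<open>a < b\<close> by (auto simp: le_iff less_iff)
        then have "y \<in> prev_level B" if "y \<in> A" for y
          using that ra rx[OF x] b by (auto simp: prev_level_def)
        moreover have "y \<in> A" if "y \<in> prev_level B" for y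
          using all[OF that] rx[OF that] ra rx[OF x] \<open>r a = r x\<close> by (auto simp: le_iff)
        ultimately show ?thesis by auto
      qed
      then show False using False by simp
    qed
    then obtain x where x: "x \<in> prev_level B" "x \<notin> down A" by auto
    then have "x < b"
      using below_prev_level[OF B(1)] b by (auto simp: below_def)
    then have "x \<in> down B - down A" "b \<in> down B - down A"
      using x sub b by (auto simp: down_def dest: order_less_imp_le)
    then show ?thesis
      using False \<open>x < b\<close> by (auto simp: link_def)
  qed
qed

text \<open>As \<open>A\<close> is nonempty, \<open>down A\<close> already contains all lower
  levels, so the difference is the antichain \<open>B - A\<close>.\<close>

lemma link_down_subset:
  fixes A B :: "'a set"
  assumes B: "antichain B" and A: "A \<noteq> {}" "A \<subset> B"
  shows "link (down A) (down B) \<longleftrightarrow> cover A B"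
proof -
  obtain a where a: "a \<in> A" using A by auto
  have rb: "r x = r a" if "x \<in> B" for x using antichain_rank[OF B that] a A by auto
  have diff: "down B - down A = B - A"
  proof (intro equalityI subsetI)
    fix x
    assume x: "x \<in> down B - down A"
    then obtain b where b: "b \<in> B" "x \<le> b" by (auto simp: down_def)
    have "\<not> r x < r a" using x a by (auto simp: down_def le_iff)
    then have "x = b" using b rb by (auto simp: le_iff)
    then show "x \<in> B - A" using x b by (auto simp: down_def)
  next
    fix x
    assume x: "x \<in> B - A"
    then have "x \<notin> down A"
      using rb A by (auto simp: down_def le_iff)
    then show "x \<in> down B - down A" using x by (auto simp: down_def)
  qed
  have "down A \<subseteq> down B" using A by (auto simp: down_def)
  then have "down B = down A \<union> (B - A)" "(B - A) \<inter> down A = {}"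
    using diff by auto
  then have "cover (down A) (down B) \<longleftrightarrow> (\<exists>p. B - A = {p})"
    by (auto simp: cover_def)
  also have "\<dots> \<longleftrightarrow> cover A B"
    using A by (auto simp: cover_def)
  finally show ?thesis
    using B unfolding link_def diff antichain_def by blast
qed

text \<open>The alternatives record which of the antichains share a level. The pair
  \<open>(A, C)\<close> has no clause of its own: its link is automatic if \<open>B\<close> is below
  \<open>C\<close>, and amounts to \<open>A \<noteq> prev_level B\<close> if \<open>B\<close> and
  \<open>C\<close> share a level.\<close>

definition order_triples :: "('a set \<times> 'a set \<times> 'a set) set" where
  "order_triples = {(A, B, C). antichain A \<and> antichain B \<and> antichain C \<and> B \<noteq> {} \<and> C \<noteq> {} \<and>
    (below A B \<and> below B C \<and> (A = prev_level B \<longrightarrow> card B = 1) \<and> (B = prev_level C \<longrightarrow> card C = 1)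
     \<or> below A B \<and> cover B C \<and> A \<noteq> prev_level B
     \<or> A \<noteq> {} \<and> cover A B \<and> below B C \<and> (B = prev_level C \<longrightarrow> card C = 1))}"

text \<open>Across levels only \<open>{}\<close> is restricted: it is joined to singletons alone. In
  the second alternative \<open>C\<close> has at least two elements, whence
  \<open>A \<noteq> {}\<close>.\<close>

definition chain_triples :: "('a set \<times> 'a set \<times> 'a set) set" where
  "chain_triples = {(A, B, C). antichain A \<and> antichain B \<and> antichain C \<and> B \<noteq> {} \<and> C \<noteq> {} \<and>
    (below A B \<and> below B C \<and> (A = {} \<longrightarrow> card B = 1 \<and> card C = 1)
     \<or> below A B \<and> cover B C \<and> A \<noteq> {}
     \<or> A \<noteq> {} \<and> cover A B \<and> below B C)}"

definition adjacent :: "'a set \<Rightarrow> 'a set \<Rightarrow> bool" where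
  "adjacent A B \<longleftrightarrow> (antichain (A \<union> B) \<longrightarrow> cover A B \<or> cover B A)"

lemma below_superset:
  fixes A :: "'a set"
  assumes "below A B" "antichain C" "B \<subseteq> C" "B \<noteq> {}"
  shows "below A C"
  unfolding below_def
proof (intro ballI)
  fix a c
  assume "a \<in> A" "c \<in> C"
  moreover obtain b where "b \<in> B" using assms(4) by auto
  ultimately have "r a < r b" "r b = r c"
    using assms antichain_rank[OF assms(2), of b c] by (auto simp: below_def less_iff)
  then show "a < c" by (simp add: less_iff)
qed

lemma weak_order:
  fixes x y z :: 'a
  shows "x < y \<Longrightarrow> x < z \<or> z < y"
  by (auto simp: less_iff)

lemma order_triples_iff:
  assumes ac: "antichain A" "antichain B" "antichain C"
  shows "(A, B, C) \<in> order_triples \<longleftrightarrow> down A \<subset> down B \<and> down B \<subset> down C \<and>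
    link (down A) (down B) \<and> link (down B) (down C) \<and> link (down A) (down C)"
proof (cases "B \<noteq> {} \<and> C \<noteq> {} \<and> (below A B \<or> A \<noteq> {} \<and> A \<subset> B) \<and> (below B C \<or> B \<subset> C)")
  case False
  then show ?thesis
    using ac by (auto simp: order_triples_def down_psubset_iff cover_def)
next
  case True
  then have ne: "B \<noteq> {}" "C \<noteq> {}" by auto
  have sub: "down A \<subset> down B" "down B \<subset> down C"
    using True ac by (auto simp: down_psubset_iff)
  have excl: "\<not> (below X Y \<and> X \<subset> Y)" if "X \<noteq> {}" for X Y :: "'a set"
    using that by (auto simp: below_def)
  have comparable: "link (down A) (down C)"
    if "b \<in> down B" "b \<notin> down A" "c \<in> C" "c \<notin> down B" "b < c" for b c
  proof -
    have "b \<in> down C - down A" "c \<in> down C - down A"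
      using that sub by (auto simp: down_def)
    then show ?thesis using that(5) by (auto simp: link_def)
  qed
  \<comment> \<open>Some \<open>b\<close> in \<open>B\<close> lies outside \<open>down A\<close>,
    and every \<open>c\<close> in \<open>C\<close> is above it.\<close>
  have AC: "link (down A) (down C)" if BC: "below B C"
  proof -
    obtain c where c: "c \<in> C" using ne by auto
    have "c \<notin> down B"
      using BC c by (auto simp: below_def down_def dest: leD)
    have "\<exists>b\<in>B. b \<notin> down A"
    proof (rule ccontr)
      assume "\<not> ?thesis"
      then have "down B \<subseteq> down A"
        using downset_down[of A] by (auto simp: downset_def down_def[of B])
      then show False using sub by auto
    qed
    then obtain b where "b \<in> B" "b \<notin> down A" by auto
    then show ?thesis
      using comparable[of b c] BC c \<open>c \<notin> down B\<close> by (auto simp: below_def down_def)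
  qed
  consider "below A B" "below B C" | "below A B" "B \<subset> C" "\<not> below B C"
    | "A \<noteq> {}" "A \<subset> B" "\<not> below A B" "below B C"
    | "A \<noteq> {}" "A \<subset> B" "\<not> below A B" "B \<subset> C" "\<not> below B C"
    using True by blast
  then show ?thesis
  proof cases
    case 1
    moreover have "\<not> cover A B" if "A \<noteq> {}"
      using that 1 not_below_cover by blast
    moreover have "\<not> cover B C"
      using ne 1 not_below_cover by blast
    ultimately show ?thesis
      using sub AC link_down_below[OF ac(1,2) ne(1) 1(1)] link_down_below[OF ac(2,3) ne(2) 1(2)]
        ac ne by (auto simp: order_triples_def)
  next
    case 2
    have lBC: "link (down B) (down C) \<longleftrightarrow> cover B C"
      using link_down_subset[OF ac(3) ne(1) 2(2)] .
    have "below A C"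
      using below_superset[OF 2(1) ac(3) _ ne(1)] 2(2) by blast
    \<comment> \<open>\<open>B\<close> and \<open>C\<close> have the same level below them and
      \<open>C\<close> is not a singleton, so the link of \<open>A\<close> with \<open>C\<close>
      demands \<open>A \<noteq> prev_level B\<close>, which also gives the link with
      \<open>B\<close>.\<close>
    from link_down_below[OF ac(1,3) ne(2) this] link_down_below[OF ac(1,2) ne(1) 2(1)]
    have "link (down A) (down B) \<and> link (down A) (down C) \<longleftrightarrow> A \<noteq> prev_level B" if "cover B C"
      using prev_level_cover[OF ac(3) that ne(1)] by auto
    moreover have "\<not> cover A B" if "A \<noteq> {}"
      using that 2 not_below_cover by blast
    ultimately show ?thesis
      using sub lBC 2 ac ne by (auto simp: order_triples_def)
  next
    case 3
    have "link (down A) (down B) \<longleftrightarrow> cover A B"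
      using link_down_subset[OF ac(2) 3(1,2)] .
    then show ?thesis
      using sub AC 3 link_down_below[OF ac(2,3) ne(2) 3(4)] ac ne by (auto simp: order_triples_def)
  next
    case 4
    have "\<not> (cover A B \<and> cover B C \<and> cover A C)"
      using not_cover_trans by blast
    moreover have "link (down A) (down C) \<longleftrightarrow> cover A C"
      using link_down_subset[OF ac(3) 4(1)] 4 by blast
    ultimately show ?thesis
      using 4 link_down_subset[OF ac(2) 4(1,2)] link_down_subset[OF ac(3) ne(1) 4(4)]
      by (auto simp: order_triples_def)
  qed
qed

lemma chain_triples_iff:
  assumes ac: "antichain A" "antichain B" "antichain C"
  shows "(A, B, C) \<in> chain_triples \<longleftrightarrow> down A \<subset> down B \<and> down B \<subset> down C \<and>
    adjacent A B \<and> adjacent B C \<and> adjacent A C"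
proof (cases "B \<noteq> {} \<and> C \<noteq> {} \<and> (below A B \<or> A \<noteq> {} \<and> A \<subset> B) \<and> (below B C \<or> B \<subset> C)")
  case False
  then show ?thesis
    using ac by (auto simp: chain_triples_def down_psubset_iff cover_def)
next
  case True
  then have ne: "B \<noteq> {}" "C \<noteq> {}" by auto
  have sub: "down A \<subset> down B" "down B \<subset> down C"
    using True ac by (auto simp: down_psubset_iff)
  \<comment> \<open>A nonempty \<open>X\<close> below \<open>Y\<close> puts a comparable pair into
    the union, so only \<open>X = {}\<close> is constrained.\<close>
  have adj_below: "adjacent X Y \<longleftrightarrow> (X = {} \<longrightarrow> card Y = 1)"
    if "below X Y" "antichain Y" "Y \<noteq> {}" for X Y :: "'a set"
  proof (cases "X = {}")
    case True
    then show ?thesis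
      using that by (auto simp: adjacent_def card_1_singleton_iff cover_def)
  next
    case False
    then have "\<not> antichain (X \<union> Y)"
      using that by (auto simp: below_def antichain_def)
    then show ?thesis using False by (simp add: adjacent_def)
  qed
  have adj_subset: "adjacent X Y \<longleftrightarrow> cover X Y" if "X \<subset> Y" "antichain Y" for X Y :: "'a set"
  proof -
    have "X \<union> Y = Y" "\<not> cover Y X" using that by (auto simp: cover_def)
    then show ?thesis using that by (simp add: adjacent_def)
  qed
  consider "below A B" "below B C" | "below A B" "B \<subset> C" "\<not> below B C"
    | "A \<noteq> {}" "A \<subset> B" "\<not> below A B" "below B C"
    | "A \<noteq> {}" "A \<subset> B" "\<not> below A B" "B \<subset> C" "\<not> below B C"
    using True by blast
  then show ?thesis
  proof cases
    case 1
    have "below A C" using below_trans 1 ne by blast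
    moreover have "\<not> cover A B" if "A \<noteq> {}"
      using that 1 not_below_cover by blast
    moreover have "\<not> cover B C"
      using ne 1 not_below_cover by blast
    ultimately show ?thesis
      using sub 1 adj_below[of A B] adj_below[of B C] adj_below[of A C] ac ne
      by (auto simp: chain_triples_def)
  next
    case 2
    have "below A C"
      using below_superset[OF 2(1) ac(3) _ ne(1)] 2(2) by blast
    moreover have "card C \<noteq> 1" if "cover B C"
      using prev_level_cover(3)[OF ac(3) that ne(1)] .
    moreover have "\<not> cover A B" if "A \<noteq> {}"
      using that 2 not_below_cover by blast
    ultimately show ?thesis
      using sub 2 adj_below[of A B] adj_subset[of B C] adj_below[of A C] ac ne
      by (auto simp: chain_triples_def)
  next
    case 3
    have "below A C" using 3 by (auto simp: below_def)
    then show ?thesis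
      using sub 3 adj_subset[of A B] adj_below[of B C] adj_below[of A C] ac ne
      by (auto simp: chain_triples_def)
  next
    case 4
    have "\<not> (cover A B \<and> cover B C \<and> cover A C)"
      using not_cover_trans by blast
    moreover have "A \<subset> C" using 4 by blast
    ultimately show ?thesis
      using 4 adj_subset[of A B] adj_subset[of B C] adj_subset[of A C] ac
      by (auto simp: chain_triples_def)
  qed
qed

section \<open>Triangular faces counted by triples\<close>

lemma card_order_triangles:
  "card (triangular_2faces (order_polytope :: (real, 'a) vec set)) = card order_triples"
proof -
  let ?S = "{S :: 'a set set. S \<subseteq> {D. downset D} \<and> card S = 3 \<and>
    convex hull (ind ` S) face_of order_polytope}"
  have mem: "antichain A \<and> antichain B \<and> antichain C" if "(A, B, C) \<in> order_triples" for A B C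
    using that by (auto simp: order_triples_def)
  have eq: "(\<lambda>(A, B, C). {down A, down B, down C}) ` order_triples = ?S"
  proof (intro equalityI subsetI)
    fix S
    assume "S \<in> (\<lambda>(A, B, C). {down A, down B, down C}) ` order_triples"
    then obtain A B C where S: "S = {down A, down B, down C}" and t: "(A, B, C) \<in> order_triples"
      by auto
    note ac = mem[OF t]
    have *: "down A \<subset> down B" "down B \<subset> down C" "link (down A) (down B)" "link (down B) (down C)"
      "link (down A) (down C)"
      using t order_triples_iff[of A B C] ac by blast+
    have "card S = 3"
      unfolding S using *(1,2) by (subst card_3_iff) blast
    moreover have "convex hull (ind ` S) face_of order_polytope"
      unfolding S using order_triangle_face[OF weak_order downset_down downset_down downset_down *] by simp
    ultimately show "S \<in> ?S"
      unfolding S by (simp add: downset_down)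
  next
    fix S
    assume "S \<in> ?S"
    then have S: "S \<subseteq> {D. downset D}" "card S = 3" "convex hull (ind ` S) face_of order_polytope"
      by auto
    have linked: "I \<subset> J \<and> link I J \<or> J \<subset> I \<and> link J I" if "I \<in> S" "J \<in> S" "I \<noteq> J" for I J
      using order_triangle_linked[OF S that] .
    obtain I J K where IJK: "S = {I, J, K}" "id I \<subset> id J" "id J \<subset> id K"
      using strict_chain_of_card_3[OF S(2), of id] linked unfolding id_def by metis
    have D: "downset I" "downset J" "downset K"
      using S(1) IJK(1) by auto
    obtain A B C where ABC: "antichain A" "I = down A" "antichain B" "J = down B" "antichain C" "K = down C"
      using downset_eq_down[OF D(1)] downset_eq_down[OF D(2)] downset_eq_down[OF D(3)] by blast
    have lt: "I \<subset> J" "J \<subset> K" "I \<subset> K"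
      using IJK by auto
    have "link I J" "link J K" "link I K"
      using linked[of I J] linked[of J K] linked[of I K] IJK(1) lt by blast+
    then have "(A, B, C) \<in> order_triples"
      using order_triples_iff[OF ABC(1,3,5)] lt unfolding ABC(2,4,6) by blast
    then show "S \<in> (\<lambda>(A, B, C). {down A, down B, down C}) ` order_triples"
      unfolding IJK(1) ABC(2,4,6) by force
  qed
  have "A \<in> {A. antichain A} \<and> B \<in> {A. antichain A} \<and> C \<in> {A. antichain A} \<and>
      down A \<subset> down B \<and> down B \<subset> down C" if "(A, B, C) \<in> order_triples" for A B C
    using mem[OF that] that order_triples_iff[of A B C] by blast
  then have "card ((\<lambda>(A, B, C). {down A, down B, down C}) ` order_triples) = card order_triples"
    by (rule card_strict_chain_triples(1)[OF _ inj_on_down])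
  moreover have "card (triangular_2faces (order_polytope :: (real, 'a) vec set)) = card ?S"
    using card_triangular_2faces[OF compact_order_polytope convex_order_polytope
        extreme_points_order_polytope] .
  ultimately show ?thesis
    by (simp only: eq)
qed

lemma card_chain_triangles:
  "card (triangular_2faces (chain_polytope :: (real, 'a) vec set)) = card chain_triples"
proof -
  let ?S = "{S :: 'a set set. S \<subseteq> {A. antichain A} \<and> card S = 3 \<and>
    convex hull (ind ` S) face_of chain_polytope}"
  have mem: "antichain A \<and> antichain B \<and> antichain C" if "(A, B, C) \<in> chain_triples" for A B C
    using that by (auto simp: chain_triples_def)
  have chain: "down A \<subset> down B \<and> down B \<subset> down C" if "(A, B, C) \<in> chain_triples" for A B C
    using mem[OF that] that chain_triples_iff[of A B C] by blast
  have eq: "(\<lambda>(A, B, C). {A, B, C}) ` chain_triples = ?S"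
  proof (intro equalityI subsetI)
    fix S
    assume "S \<in> (\<lambda>(A, B, C). {A, B, C}) ` chain_triples"
    then obtain A B C where S: "S = {A, B, C}" and t: "(A, B, C) \<in> chain_triples"
      by auto
    have ac: "antichain A" "antichain B" "antichain C" using mem[OF t] by auto
    have ne: "B \<noteq> {}" "C \<noteq> {}" using t by (auto simp: chain_triples_def)
    have "A \<noteq> B" "B \<noteq> C" "A \<noteq> C"
      using chain[OF t] by auto
    then have "card S = 3"
      unfolding S by simp
    moreover have "convex hull {ind A, ind B, ind C} face_of chain_polytope"
    proof -
      consider "below A B" "below B C" "A = {}" "card B = 1" "card C = 1"
        | "below A B" "below B C" "A \<noteq> {}" | "below A B" "cover B C" "A \<noteq> {}"
        | "A \<noteq> {}" "cover A B" "below B C"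
        using t unfolding chain_triples_def by blast
      then show ?thesis
      proof cases
        case 1
        then obtain p q where "B = {p}" "C = {q}" by (auto simp: card_1_singleton_iff)
        then show ?thesis
          using 1 chain_triangle_origin[of p q] by (simp add: below_def)
      next
        case 2
        then show ?thesis using chain_triangle_three_levels[OF ac] ne by blast
      next
        case 3
        have "below A C"
          using below_superset[OF 3(1) ac(3) _ ne(1)] 3(2) by (auto simp: cover_def)
        \<comment> \<open>\<open>chain_triangle_two_levels\<close> takes the two antichains of the
          shared level first, so the triple is rotated.\<close>
        then have "convex hull {ind B, ind C, ind A} face_of chain_polytope"
          using chain_triangle_two_levels[OF ac(2,3,1)] ne 3 by blast
        moreover have "{ind B, ind C, ind A} = {ind A, ind B, ind C}" by auto
        ultimately show ?thesis by simp
      next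
        case 4
        then show ?thesis using chain_triangle_two_levels[OF ac] ne by blast
      qed
    qed
    ultimately show "S \<in> ?S"
      unfolding S using ac by simp
  next
    fix S
    assume "S \<in> ?S"
    then have S: "S \<subseteq> {A. antichain A}" "card S = 3" "convex hull (ind ` S) face_of chain_polytope"
      by auto
    have adj: "adjacent A B" if "A \<in> S" "B \<in> S" "A \<noteq> B" for A B
      using chain_triangle_linked[OF S that] by (simp add: adjacent_def)
    have comp: "down A \<subset> down B \<or> down B \<subset> down A" if AB: "A \<in> S" "B \<in> S" "A \<noteq> B" for A B
    proof -
      have ac: "antichain A" "antichain B" using S(1) AB by auto
      consider "cover A B" | "cover B A" | "\<not> antichain (A \<union> B)"
        using adj[OF AB] by (auto simp: adjacent_def)
      then show ?thesis
      proof cases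
        case 1
        then show ?thesis
          using ac by (cases "A = {}") (auto simp: down_psubset_iff cover_def)
      next
        case 2
        then show ?thesis
          using ac by (cases "B = {}") (auto simp: down_psubset_iff cover_def)
      next
        case 3
        then have ne: "A \<noteq> {}" "B \<noteq> {}" using ac by auto
        then obtain a b where ab: "a \<in> A" "b \<in> B" by auto
        have ra: "r x = r a" if "x \<in> A" for x using antichain_rank[OF ac(1) that ab(1)] .
        have rb: "r x = r b" if "x \<in> B" for x using antichain_rank[OF ac(2) that ab(2)] .
        have "r a \<noteq> r b"
          using 3 antichainI[of "A \<union> B"] ra rb by (metis Un_iff)
        then have "below A B \<or> below B A"
          using ra rb by (auto simp: below_def less_iff)
        then show ?thesis
          using ac ne by (auto simp: down_psubset_iff)
      qed
    qed
    obtain A B C where ABC: "S = {A, B, C}" "down A \<subset> down B" "down B \<subset> down C"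
      using comp by (rule strict_chain_of_card_3[OF S(2)])
    have "A \<noteq> B" "B \<noteq> C" "A \<noteq> C" using ABC(2,3) by auto
    then have "adjacent A B" "adjacent B C" "adjacent A C"
      by (auto intro!: adj simp: ABC(1))
    moreover have "antichain A" "antichain B" "antichain C"
      using S(1) ABC(1) by auto
    ultimately have "(A, B, C) \<in> chain_triples"
      using chain_triples_iff[of A B C] ABC(2,3) by blast
    then show "S \<in> (\<lambda>(A, B, C). {A, B, C}) ` chain_triples"
      unfolding ABC(1) by force
  qed
  have "A \<in> {A. antichain A} \<and> B \<in> {A. antichain A} \<and> C \<in> {A. antichain A} \<and>
      down A \<subset> down B \<and> down B \<subset> down C" if "(A, B, C) \<in> chain_triples" for A B C
    using mem[OF that] chain[OF that] by blast
  then have "card ((\<lambda>(A, B, C). {A, B, C}) ` chain_triples) = card chain_triples"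
    by (rule card_strict_chain_triples(2)[OF _ inj_on_down])
  moreover have "card (triangular_2faces (chain_polytope :: (real, 'a) vec set)) = card ?S"
    using card_triangular_2faces[OF compact_chain_polytope convex_chain_polytope
        extreme_points_chain_polytope] .
  ultimately show ?thesis
    by (simp only: eq)
qed

text \<open>Both families of triples are compared inside \<open>all_triples\<close>: the chain triples are its part
  without \<open>minimum_triples\<close>, and exchanging \<^term>\<open>{}\<close> with \<^term>\<open>prev_level B\<close> in the first place
  turns the order triples into its part without \<open>level_triples\<close>.\<close>

definition all_triples :: "('a set \<times> 'a set \<times> 'a set) set" where
  "all_triples = {(A, B, C). antichain A \<and> antichain B \<and> antichain C \<and> B \<noteq> {} \<and> C \<noteq> {} \<and>
    (below A B \<and> below B C \<and> (A = {} \<longrightarrow> card B = 1)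
     \<or> below A B \<and> cover B C \<and> A \<noteq> {}
     \<or> A \<noteq> {} \<and> cover A B \<and> below B C)}"

lemma all_triplesI:
  assumes "antichain A" "antichain B" "antichain C" "B \<noteq> {}" "C \<noteq> {}" "below B C"
  shows "below A B \<Longrightarrow> (A = {} \<Longrightarrow> card B = 1) \<Longrightarrow> (A, B, C) \<in> all_triples"
    and "A \<noteq> {} \<Longrightarrow> cover A B \<Longrightarrow> (A, B, C) \<in> all_triples"
  using assms by (simp_all add: all_triples_def)

text \<open>Here the order polytope rejects the pair \<open>(B, C)\<close>: the downset grows by the
  antichain \<open>C\<close>, which has at least two elements.\<close>

definition level_triples :: "('a set \<times> 'a set \<times> 'a set) set" where
  "level_triples = {(A, B, C) \<in> all_triples. B = prev_level C \<and> card C \<noteq> 1}"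

text \<open>Here the chain polytope rejects the pair \<open>({}, C)\<close>; the middle antichain is
  a singleton.\<close>

definition minimum_triples :: "('a set \<times> 'a set \<times> 'a set) set" where
  "minimum_triples = {(A, B, C) \<in> all_triples. A = {} \<and> card C \<noteq> 1}"

definition excess_triples :: "('a set \<times> 'a set \<times> 'a set) set" where
  "excess_triples = {(A, B, C) \<in> level_triples. below A B \<and> 2 \<le> card A}"

lemma chain_triples_eq: "chain_triples = all_triples - minimum_triples"
  unfolding chain_triples_def all_triples_def minimum_triples_def by blast

text \<open>The test selects the triples whose first place is restricted: there
  \<open>order_triples\<close> forbids \<open>prev_level B\<close> and \<open>all_triples\<close>
  forbids \<open>{}\<close>. If \<open>B\<close> is a singleton on a lower level than
  \<open>C\<close>, both are allowed and nothing moves.\<close>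

definition exchange :: "'a set \<times> 'a set \<times> 'a set \<Rightarrow> 'a set \<times> 'a set \<times> 'a set" where
  "exchange = (\<lambda>(A, B, C).
    if below A B \<and> (cover B C \<or> card B \<noteq> 1)
    then (if A = {} then prev_level B else if A = prev_level B then {} else A, B, C)
    else (A, B, C))"

text \<open>Both \<open>{}\<close> and \<open>prev_level B\<close> lie below \<open>B\<close>, so
  the swap does not affect its own test.\<close>

lemma exchange_exchange:
  assumes "antichain B"
  shows "exchange (exchange (A, B, C)) = (A, B, C)"
  using below_prev_level[OF assms] by (auto simp: exchange_def)

lemma bij_betw_exchange: "bij_betw exchange order_triples (all_triples - level_triples)"
proof (rule bij_betw_byWitness[where f' = exchange])
  show "\<forall>t\<in>order_triples. exchange (exchange t) = t"
    by (auto simp: order_triples_def exchange_exchange)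
  show "\<forall>t\<in>all_triples - level_triples. exchange (exchange t) = t"
    by (auto simp: all_triples_def exchange_exchange)
  show "exchange ` order_triples \<subseteq> all_triples - level_triples"
  proof (rule image_subsetI, simp only: split_paired_all)
    fix A B C
    assume t: "(A, B, C) \<in> order_triples"
    then have ac: "antichain A" "antichain B" "antichain C" and ne: "B \<noteq> {}" "C \<noteq> {}"
      by (auto simp: order_triples_def)
    note prev = antichain_prev_level[OF ac(2)] below_prev_level[OF ac(2)]
    consider "below A B" "below B C" "A = prev_level B \<longrightarrow> card B = 1" "B = prev_level C \<longrightarrow> card C = 1"
      | "below A B" "cover B C" "A \<noteq> prev_level B"
      | "A \<noteq> {}" "cover A B" "below B C" "B = prev_level C \<longrightarrow> card C = 1"
      using t unfolding order_triples_def by blast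
    then show "exchange (A, B, C) \<in> all_triples - level_triples"
    proof cases
      case 1
      have "\<not> cover B C" using 1 ne not_below_cover by blast
      then show ?thesis
        using 1 ac ne prev by (auto simp: exchange_def all_triples_def level_triples_def)
    next
      case 2
      then show ?thesis
        using ac ne prev prev_level_cover[OF ac(3) 2(2) ne(1)]
        by (auto simp: exchange_def all_triples_def level_triples_def)
    next
      case 3
      have "\<not> below A B" using 3 not_below_cover by blast
      then show ?thesis
        using 3 ac ne by (auto simp: exchange_def all_triples_def level_triples_def)
    qed
  qed
  show "exchange ` (all_triples - level_triples) \<subseteq> order_triples"
  proof (rule image_subsetI, simp only: split_paired_all)
    fix A B C
    assume t: "(A, B, C) \<in> all_triples - level_triples"
    then have ac: "antichain A" "antichain B" "antichain C" and ne: "B \<noteq> {}" "C \<noteq> {}"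
      and lv: "B = prev_level C \<longrightarrow> card C = 1"
      by (auto simp: all_triples_def level_triples_def)
    note prev = antichain_prev_level[OF ac(2)] below_prev_level[OF ac(2)]
    consider "below A B" "below B C" "A = {} \<longrightarrow> card B = 1"
      | "below A B" "cover B C" "A \<noteq> {}"
      | "A \<noteq> {}" "cover A B" "below B C"
      using t unfolding all_triples_def by blast
    then show "exchange (A, B, C) \<in> order_triples"
    proof cases
      case 1
      have "\<not> cover B C" using 1 ne not_below_cover by blast
      then show ?thesis
        using 1 ac ne prev lv by (auto simp: exchange_def order_triples_def)
    next
      case 2
      then show ?thesis
        using ac ne prev by (auto simp: exchange_def order_triples_def)
    next
      case 3
      have "\<not> below A B" using 3 not_below_cover by blast
      then show ?thesis
        using 3 ac ne lv by (auto simp: exchange_def order_triples_def)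
    qed
  qed
qed

text \<open>Applied with \<open>B = {b}\<close>, where the first entry must remember
  \<open>b\<close> once the level is inserted. If \<open>b\<close> lies lower, \<open>{b}\<close>
  does so; if \<open>b\<close> belongs to the level, its complement there does, being covered by the
  level.\<close>

definition insert_level :: "'a set \<times> 'a set \<times> 'a set \<Rightarrow> 'a set \<times> 'a set \<times> 'a set" where
  "insert_level = (\<lambda>(A, B, C).
    if B \<subseteq> prev_level C then (prev_level C - B, prev_level C, C) else (B, prev_level C, C))"

lemma minimum_triplesE:
  assumes "t \<in> minimum_triples"
  obtains b C where "t = ({}, {b}, C)" "antichain C" "C \<noteq> {}" "card C \<noteq> 1" "below {b} C"
  using assms by (auto simp: minimum_triples_def all_triples_def card_1_singleton_iff)

lemma minimum_triplesI:
  assumes "antichain C" "C \<noteq> {}" "card C \<noteq> 1" "below {b} C"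
  shows "({}, {b}, C) \<in> minimum_triples"
  using assms by (auto simp: minimum_triples_def all_triples_def antichain_def)

lemma insert_level_cases:
  assumes C: "antichain C" "C \<noteq> {}" "card C \<noteq> 1" and b: "below {b} C"
  shows "insert_level ({}, {b}, C) \<in> level_triples - excess_triples"
proof -
  note prev = antichain_prev_level[OF C(1)] below_prev_level[OF C(1)]
  obtain c where c: "c \<in> C" using C by auto
  have "b < c" using b c by (auto simp: below_def)
  then have ne: "prev_level C \<noteq> {}" using prev_level_nonempty[OF c] by blast
  show ?thesis
  proof (cases "b \<in> prev_level C")
    case True
    have cov: "cover (prev_level C - {b}) (prev_level C)"
      using True by (auto simp: cover_def)
    have "\<not> (below (prev_level C - {b}) (prev_level C) \<and> 2 \<le> card (prev_level C - {b}))"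
      using not_below_cover[OF _ cov] by (metis card.empty not_numeral_le_zero)
    then have "(prev_level C - {b}, prev_level C, C) \<notin> excess_triples"
      by (simp add: excess_triples_def)
    moreover have "(prev_level C - {b}, prev_level C, C) \<in> all_triples"
    proof (cases "prev_level C - {b} = {}")
      \<comment> \<open>If \<open>b\<close> is the whole level, the first entry becomes
        \<open>{}\<close>, and the inserted level is a singleton, as \<open>all_triples\<close>
        demands of it.\<close>
      case empty: True
      have "card (prev_level C) = 1"
        using cov unfolding empty card_eq_1_iff_cover .
      then show ?thesis
        unfolding empty using prev ne C by (intro all_triplesI) auto
    next
      case False
      moreover have "antichain (prev_level C - {b})"
        using prev(1) by (auto simp: antichain_def)
      ultimately show ?thesis
        using cov prev ne C by (intro all_triplesI(2))
    qed
    ultimately show ?thesis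
      using True C(3) by (simp add: insert_level_def level_triples_def)
  next
    case False
    have "b < x" if x: "x \<in> prev_level C" for x
    proof -
      obtain d where d: "d \<in> C" "Suc (r x) = r d" using x by (auto simp: prev_level_def)
      then have "r b < Suc (r x)" using b by (auto simp: below_def less_iff)
      moreover have "r b \<noteq> r x" using False d by (auto simp: prev_level_def)
      ultimately show ?thesis by (simp add: less_iff)
    qed
    then have "below {b} (prev_level C)" by (simp add: below_def)
    moreover have "antichain {b}" by (simp add: antichain_def)
    ultimately have "({b}, prev_level C, C) \<in> all_triples"
      using prev ne C by (intro all_triplesI(1)) auto
    then show ?thesis
      using False C(3) by (simp add: insert_level_def level_triples_def excess_triples_def)
  qed
qed

lemma bij_betw_insert_level:
  "bij_betw insert_level minimum_triples (level_triples - excess_triples)"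
  unfolding bij_betw_def
proof
  show "inj_on insert_level minimum_triples"
  proof (rule inj_onI)
    fix s t
    assume "s \<in> minimum_triples" "t \<in> minimum_triples" and eq: "insert_level s = insert_level t"
    then obtain b C d D where st: "s = ({}, {b}, C)" "t = ({}, {d}, D)"
      by (elim minimum_triplesE) blast
    have CD: "C = D"
      using eq unfolding st by (auto simp: insert_level_def split: if_splits)
    \<comment> \<open>The first entry shows which branch was taken: it lies inside the level and
      misses only \<open>b\<close>, or it is \<open>{b}\<close> with \<open>b\<close> outside the
      level.\<close>
    have "b = d"
      using eq unfolding st CD by (auto simp: insert_level_def split: if_splits)
    then show "s = t" using CD st by simp
  qed
  show "insert_level ` minimum_triples = level_triples - excess_triples"
  proof (intro equalityI subsetI)
    fix t
    assume "t \<in> insert_level ` minimum_triples"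
    then obtain s where s: "s \<in> minimum_triples" "t = insert_level s" by blast
    obtain b C where "s = ({}, {b}, C)" "antichain C" "C \<noteq> {}" "card C \<noteq> 1" "below {b} C"
      using s(1) by (rule minimum_triplesE)
    then show "t \<in> level_triples - excess_triples"
      unfolding s(2) using insert_level_cases by blast
  next
    fix t
    assume t: "t \<in> level_triples - excess_triples"
    obtain A B C where ABC: "t = (A, B, C)" by (cases t)
    have B: "B = prev_level C" and C: "antichain C" "C \<noteq> {}" "card C \<noteq> 1" and "B \<noteq> {}"
      using t unfolding ABC by (auto simp: level_triples_def all_triples_def)
    have BC: "below B C" unfolding B by (rule below_prev_level[OF C(1)])
    have "\<not> cover B C" using not_below_cover[OF BC] \<open>B \<noteq> {}\<close> by blast
    \<comment> \<open>Without the excess triples, \<open>A\<close> is a singleton below the level or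
      the level minus one element, possibly \<open>{}\<close>; either way it names exactly one
      \<open>b\<close>.\<close>
    then consider "A = {}" "card B = 1" | "A \<noteq> {}" "below A B" "card A < 2"
      | "A \<noteq> {}" "cover A B"
      using t unfolding ABC level_triples_def all_triples_def excess_triples_def by fastforce
    then show "t \<in> insert_level ` minimum_triples"
    proof cases
      case 1
      then obtain b where "B = {b}" by (auto simp: card_1_singleton_iff)
      then have "insert_level ({}, {b}, C) = t" "({}, {b}, C) \<in> minimum_triples"
        using B BC 1 C minimum_triplesI by (auto simp: ABC insert_level_def)
      then show ?thesis by force
    next
      case 2
      then have "card A = 1"
        using card_gt_0_iff[of A] by (simp add: less_Suc_eq numeral_2_eq_2)
      then obtain a where a: "A = {a}" by (auto simp: card_1_singleton_iff)
      have "a \<notin> B" using 2 a by (auto simp: below_def)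
      moreover have "below {a} C" using below_trans[OF 2(2) BC \<open>B \<noteq> {}\<close>] a by simp
      ultimately have "insert_level ({}, {a}, C) = t" "({}, {a}, C) \<in> minimum_triples"
        using B C minimum_triplesI a by (auto simp: ABC insert_level_def)
      then show ?thesis by force
    next
      case 3
      then obtain p where p: "p \<notin> A" "B = insert p A" by (auto simp: cover_def)
      have "below {p} C" using BC p(2) by (auto simp: below_def)
      moreover have "insert_level ({}, {p}, C) = t"
        using p B by (auto simp: ABC insert_level_def)
      ultimately show ?thesis using C minimum_triplesI by force
    qed
  qed
qed

text \<open>The chain side exceeds the order side by exactly
  \<open>card excess_triples\<close>.\<close>

lemma card_triples_eq_iff: "card order_triples = card chain_triples \<longleftrightarrow> excess_triples = {}"
proof -
  have sub: "level_triples \<subseteq> all_triples" "minimum_triples \<subseteq> all_triples"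
    "excess_triples \<subseteq> level_triples"
    by (auto simp: level_triples_def minimum_triples_def excess_triples_def)
  have "card order_triples = card all_triples - card level_triples"
    using bij_betw_same_card[OF bij_betw_exchange] sub by (simp add: card_Diff_subset)
  moreover have "card chain_triples = card all_triples - card minimum_triples"
    using sub by (simp add: chain_triples_eq card_Diff_subset)
  moreover have "card minimum_triples = card level_triples - card excess_triples"
    using bij_betw_same_card[OF bij_betw_insert_level] sub by (simp add: card_Diff_subset)
  moreover have "card level_triples \<le> card all_triples" "card minimum_triples \<le> card all_triples"
    "card excess_triples \<le> card level_triples"
    using sub by (auto intro: card_mono)
  ultimately have "card order_triples = card chain_triples \<longleftrightarrow> card excess_triples = 0"
    by linarith
  then show ?thesis by simp
qed

lemma excess_triples_empty_iff: "excess_triples = {} \<longleftrightarrow> \<not> contains_X TYPE('a)"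
proof
  assume empty: "excess_triples = {}"
  show "\<not> contains_X TYPE('a)"
  proof
    assume "contains_X TYPE('a)"
    then obtain a b c d e :: 'a where X: "distinct [a, b, c, d, e]" "\<not> a \<le> b" "\<not> b \<le> a"
      "\<not> d \<le> e" "\<not> e \<le> d" "a < c" "c < d" "b < c" "c < e"
      unfolding contains_X_def by blast
    have ac: "antichain {a, b}" "antichain {d, e}"
      using X(2-5) by (auto simp: antichain_def dest: order_less_imp_le)
    have "c < d" using X by simp
    then have ne: "prev_level {d, e} \<noteq> {}"
      using prev_level_nonempty[of d "{d, e}" c] by simp
    \<comment> \<open>The middle antichain is the level just below \<open>d\<close> and
      \<open>e\<close>, which may be higher than that of \<open>c\<close>; it is never lower, hence
      it is above \<open>a\<close> and \<open>b\<close>.\<close>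
    have "below {a, b} (prev_level {d, e})"
      using X(6-9) by (auto simp: below_def prev_level_def less_iff)
    moreover have "card {a, b} = 2" "card {d, e} = 2"
      using X(1) by auto
    ultimately have "({a, b}, prev_level {d, e}, {d, e}) \<in> excess_triples"
      using ac ne antichain_prev_level[OF ac(2)] below_prev_level[OF ac(2)]
      by (auto simp: excess_triples_def level_triples_def all_triples_def)
    then show False using empty by blast
  qed
next
  assume noX: "\<not> contains_X TYPE('a)"
  show "excess_triples = {}"
  proof (rule ccontr)
    assume "excess_triples \<noteq> {}"
    then obtain A B C where t: "(A, B, C) \<in> excess_triples" by auto
    then have *: "antichain A" "antichain C" "B = prev_level C" "B \<noteq> {}" "C \<noteq> {}" "card C \<noteq> 1"
      "below A B" "2 \<le> card A"
      by (auto simp: excess_triples_def level_triples_def all_triples_def)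
    obtain c where c: "c \<in> B" using * by auto
    have BC: "below B C" using * below_prev_level by blast
    have two: "\<exists>x y. x \<in> S \<and> y \<in> S \<and> x \<noteq> y" if "2 \<le> card S" for S :: "'a set"
      using that card_le_Suc0_iff_eq[of S] by fastforce
    have "card C \<noteq> 0" using * by simp
    then have "2 \<le> card C" using *(6) by linarith
    then obtain d e where de: "d \<in> C" "e \<in> C" "d \<noteq> e" using two by blast
    obtain a b where ab: "a \<in> A" "b \<in> A" "a \<noteq> b" using two *(8) by blast
    have lt: "a < c" "b < c" "c < d" "c < e"
      using *(7) BC c ab de by (auto simp: below_def)
    then have "distinct [a, b, c, d, e]"
      using ab(3) de(3) by auto
    moreover have "\<not> a \<le> b" "\<not> b \<le> a" "\<not> d \<le> e" "\<not> e \<le> d"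
      using ab de *(1,2) by (auto simp: antichain_def order_le_less)
    ultimately show False
      using noX lt unfolding contains_X_def by blast
  qed
qed

end

section \<open>Maximal ranked posets\<close>

text \<open>Incomparable elements have the same elements below them, so the number \<open>f\<close>
  of these is constant on levels and strictly increasing, but may skip values. Counting the distinct
  values of \<open>f\<close> below \<open>p\<close> closes the gaps.\<close>

lemma ranked_order_exists:
  assumes weak: "\<And>x y z :: 'a::{finite,order}. x < y \<Longrightarrow> x < z \<or> z < y"
  shows "\<exists>r :: 'a \<Rightarrow> nat. ranked_order r"
proof -
  define f where "f p = card {q. q < p}" for p :: 'a
  define r where "r p = card (f ` {q. q < p})" for p :: 'a
  have f_mono: "f x < f y" if "x < y" for x y
    unfolding f_def using that by (intro psubset_card_mono) auto
  have eq: "{q. q < x} = {q. q < y}" if "\<not> x < y" "\<not> y < x" for x y :: 'a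
    using that weak by blast
  have r_mono: "r x < r y" if "x < y" for x y
    unfolding r_def
  proof (rule psubset_card_mono)
    have "f ` {q. q < x} \<subseteq> f ` {q. q < y}" using that by auto
    moreover have "f x \<notin> f ` {q. q < x}" using f_mono by fastforce
    moreover have "f x \<in> f ` {q. q < y}" using that by auto
    ultimately show "f ` {q. q < x} \<subset> f ` {q. q < y}" by blast
  qed simp
  have less_iff: "x < y \<longleftrightarrow> r x < r y" for x y
  proof
    assume "r x < r y"
    show "x < y"
    proof (rule ccontr)
      assume "\<not> x < y"
      moreover have "\<not> y < x" using r_mono[of y x] \<open>r x < r y\<close> by auto
      ultimately have "r x = r y" unfolding r_def using eq[of x y] by simp
      then show False using \<open>r x < r y\<close> by simp
    qed
  qed (rule r_mono)
  have "\<exists>y. Suc (r y) = r x" if "r x \<noteq> 0" for x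
  proof -
    have "{q. q < x} \<noteq> {}" using that by (auto simp: r_def)
    \<comment> \<open>For a maximal \<open>y\<close> below \<open>x\<close>, every element below
      \<open>x\<close> is below \<open>y\<close> or on its level, so \<open>f y\<close> is the only
      new value.\<close>
    then obtain y where y: "y < x" "\<And>z. z < x \<Longrightarrow> y \<le> z \<Longrightarrow> y = z"
      using finite_has_maximal[of "{q. q < x}"] by auto
    have "f ` {q. q < x} = insert (f y) (f ` {q. q < y})"
    proof -
      have "f z \<in> insert (f y) (f ` {q. q < y})" if "z < x" for z
      proof (cases "z < y")
        case False
        have "\<not> y < z" using y(2)[OF that] by (auto dest: order_less_imp_le)
        then have "f z = f y" unfolding f_def using eq[OF False] by simp
        then show ?thesis by simp
      qed simp
      moreover have "f z \<in> f ` {q. q < x}" if "z < y" for z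
        using that y(1) by (auto intro: less_trans)
      ultimately show ?thesis using y(1) by auto
    qed
    moreover have "f y \<notin> f ` {q. q < y}" using f_mono by fastforce
    ultimately have "r x = Suc (r y)" by (simp add: r_def)
    then show ?thesis by metis
  qed
  then have "ranked_order r"
    using less_iff by unfold_locales
  then show ?thesis by blast
qed

lemma maximal_chain_extends:
  fixes D :: "'a::{finite,order} set"
  assumes "is_chain D"
  obtains C where "maximal_chain C" "D \<subseteq> C"
proof -
  have "finite {C. is_chain C \<and> D \<subseteq> C}" "D \<in> {C. is_chain C \<and> D \<subseteq> C}"
    using assms by auto
  then obtain C where C: "C \<in> {C. is_chain C \<and> D \<subseteq> C}" "D \<subseteq> C"
    "\<And>E. E \<in> {C. is_chain C \<and> D \<subseteq> C} \<Longrightarrow> C \<subseteq> E \<Longrightarrow> C = E"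
    using finite_has_maximal2[of "{C. is_chain C \<and> D \<subseteq> C}" D] by metis
  then have "maximal_chain C"
    unfolding maximal_chain_def by blast
  then show thesis using that C(2) by blast
qed

text \<open>Two comparable elements have distinct ranks in a common maximal chain, so an element
  incomparable to both would have to share all its ranks with each of them.\<close>

lemma maximal_ranked_weak:
  fixes x y z :: "'a::{finite,order}"
  assumes "maximal_ranked TYPE('a)" "x < y"
  shows "x < z \<or> z < y"
proof (rule ccontr)
  assume *: "\<not> (x < z \<or> z < y)"
  have rank: "\<And>i j p q :: 'a. i \<noteq> j \<Longrightarrow> p \<in> rank_level i \<Longrightarrow> q \<in> rank_level j \<Longrightarrow> p \<le> q \<or> q \<le> p"
    using assms(1) unfolding maximal_ranked_def by blast
  have inc: "\<not> x \<le> z" "\<not> z \<le> x" "\<not> y \<le> z" "\<not> z \<le> y"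
    using * assms(2) by (auto simp: order_le_less dest: less_trans)
  have "is_chain {z}" by (simp add: is_chain_def)
  then obtain Z where Z: "maximal_chain Z" "{z} \<subseteq> Z" by (rule maximal_chain_extends)
  define k where "k = card {q \<in> Z. q < z}"
  have z: "z \<in> rank_level k" using Z by (auto simp: rank_level_def k_def)
  have "is_chain {x, y}" using assms(2) by (auto simp: is_chain_def)
  then obtain C where C: "maximal_chain C" "{x, y} \<subseteq> C" by (rule maximal_chain_extends)
  define i where "i = card {q \<in> C. q < x}"
  define j where "j = card {q \<in> C. q < y}"
  have xy: "x \<in> rank_level i" "y \<in> rank_level j"
    using C by (auto simp: rank_level_def i_def j_def)
  have "{q \<in> C. q < x} \<subset> {q \<in> C. q < y}"
    using assms(2) C(2) by auto
  then have "i < j"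
    unfolding i_def j_def by (intro psubset_card_mono) auto
  moreover have "i = k" using rank[OF _ xy(1) z] inc by blast
  moreover have "j = k" using rank[OF _ xy(2) z] inc by blast
  ultimately show False by simp
qed

theorem theorem3p6:
  assumes "maximal_ranked TYPE('a::{finite,order})"
  shows "card (triangular_2faces (order_polytope :: (real^'a::{finite,order}) set))
           = card (triangular_2faces (chain_polytope :: (real^'a::{finite,order}) set))
         \<longleftrightarrow> \<not> contains_X TYPE('a::{finite,order})"
proof -
  obtain r :: "'a \<Rightarrow> nat" where "ranked_order r"
    using ranked_order_exists[OF maximal_ranked_weak[OF assms]] by blast
  then interpret ranked_order r .
  show ?thesis
    by (simp only: card_order_triangles card_chain_triangles card_triples_eq_iff
        excess_triples_empty_iff)
qed

end
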